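(* Let $\{X_{k,i}; i \geq 1, k \geq 1\}$ be an array of i.i.d. random variables, write $X_i = X_{1,i}$ for $i \geq 1$, and let $\{p_n; n \geq 1\}$ be a sequence of positive integers such that $n/p_n$ is bounded away from $0$ and $\infty$. Define $$W_n = \max_{1 \leq i < j \leq p_n} \Big| \sum_{k=1}^n X_{k,i} X_{k,j} \Big|, \quad n \geq 1.$$ Let $\alpha > 1/2$. Then $$\lim_{n \to \infty} \frac{W_n}{n^\alpha} = 0 \quad \text{a.s.}$$ if and only if $$\sum_{n=1}^{\infty} P\Big(\max_{1 \leq i < j \leq n} |X_i X_j| \geq n^\alpha\Big) < \infty$$ and, in the case $\alpha \leq 1$, additionally $EX_1 = 0$. *)

theory Defs
  imports "HOL-Probability.Probability"
begin

text \<open>W_n = max over 1 <= i < j <= p_n of |sum_{k=1}^n X_{k,i} X_{k,j}|.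
  The 0 inserted only fixes the value when the index set is empty (p_n < 2);
  otherwise it does not change the maximum since all entries are nonnegative.\<close>
definition W_stat :: "(nat \<Rightarrow> nat \<Rightarrow> 'a \<Rightarrow> real) \<Rightarrow> (nat \<Rightarrow> nat) \<Rightarrow> nat \<Rightarrow> 'a \<Rightarrow> real" where
  "W_stat X p n \<omega> =
     Max (insert 0 {\<bar>\<Sum>k=1..n. X k i \<omega> * X k j \<omega>\<bar> | i j. 1 \<le> i \<and> i < j \<and> j \<le> p n})"

definition max_prod :: "(nat \<Rightarrow> nat \<Rightarrow> 'a \<Rightarrow> real) \<Rightarrow> nat \<Rightarrow> 'a \<Rightarrow> real" where
  "max_prod X n \<omega> =
     Max (insert 0 {\<bar>X 1 i \<omega> * X 1 j \<omega>\<bar> | i j. 1 \<le> i \<and> i < j \<and> j \<le> n})"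

end

theory Submission
  imports Defs "HOL-Real_Asymp.Real_Asymp"
begin

text \<open>
  Call a product of two entries of row \<open>n\<close> large if it reaches \<open>n powr \<alpha>\<close>. Such a product is the
  increment of a sum occurring in \<open>W_n\<close>, so \<open>W_n / n powr \<alpha> \<longlonglongrightarrow> 0\<close> forbids large products among the
  first \<open>c * n\<close> columns of row \<open>n\<close>, and since the rows are independent, the converse Borel-Cantelli
  lemma gives the series condition. The law of large numbers along \<open>n = 2 ^ k\<close> for the products of
  the first two columns gives mean zero.

  Conversely, the series condition bounds the probability of large products in whole dyadic blocks
  of rows, so that almost surely all entry products eventually stay below \<open>e * n powr \<alpha>\<close>. It also
  yields a finite moment of order \<open>2 / \<alpha>\<close> for one product of two entries, which is enough for an
  exponential inequality to make the sums of truncated products exceed \<open>\<epsilon> * n powr \<alpha>\<close> with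
  probability \<open>O(n powr (- 5))\<close>; a union bound over the \<open>O(n powr 2)\<close> pairs of columns is then
  summable.
\<close>

text \<open>A row stays in every later sum, so at time \<open>n\<close> all \<open>n\<close> rows
  must be free of large products, while the series condition gives each value of \<open>q\<close>
  only weight 1. Dyadic blocks restore the balance: a block costs about \<open>2 ^ k\<close> times
  one value of \<open>q\<close>, which is comparable to the sum of \<open>q\<close> over a whole
  block of indices. This works because \<open>q\<close> grows at most by a constant factor when the
  number of columns does. The order \<open>2 / \<alpha>\<close> comes from independence inside one
  row: about \<open>n / 2\<close> of the products are independent, so one product is large with
  probability at most a constant times \<open>q n / n\<close>. Hence, for Z the power
  \<open>1 / \<alpha>\<close> of the absolute product, the sum of n P(Z >= n) is finite, and Z has a
  finite second moment. The bound \<alpha> > 1/2 is what makes the variance of a sum of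
  \<open>n\<close> truncated products of smaller order than \<open>n powr (2 * \<alpha>)\<close>.
  Their means are controlled by centring if \<alpha> \<le> 1; if \<alpha> > 1, an absolute moment of
  order at most 1 makes them small by itself. For \<alpha> \<le> 1 the integrability of an entry
  belongs to the conclusion and has to be recovered from the product of two entries.\<close>

section \<open>Exponential tail bounds for sums of bounded independent variables\<close>

lemma exp_le_quadratic:
  fixes u a :: real
  assumes "\<bar>u\<bar> \<le> a"
  shows "exp u \<le> 1 + u + u\<^sup>2 * exp a"
proof -
  obtain t where t: "\<bar>t\<bar> \<le> \<bar>u\<bar>" and e: "exp u = (\<Sum>m<2. u ^ m / fact m) + exp t / fact 2 * u\<^sup>2"
    using Maclaurin_exp_le[of u 2] by auto
  have "exp t / 2 * u\<^sup>2 \<le> exp a * u\<^sup>2"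
    using t assms by (intro mult_right_mono order_trans[of "exp t / 2" "exp t" "exp a"]) auto
  then show ?thesis
    using e by (simp add: numeral_2_eq_2 mult.commute)
qed

context prob_space
begin

text \<open>Integrating the quadratic bound for \<open>exp (t * Y)\<close> and then using 1 + z
  \<le> exp z. The exponential form on the right lets the bounds of independent factors multiply
  into a sum in the exponent.\<close>

lemma expectation_exp_le:
  fixes Y :: "'a \<Rightarrow> real" and y t :: real
  assumes [measurable]: "random_variable borel Y"
    and bd: "\<And>\<omega>. \<omega> \<in> space M \<Longrightarrow> \<bar>Y \<omega>\<bar> \<le> y" and t: "0 \<le> t"
  shows "expectation (\<lambda>\<omega>. exp (t * Y \<omega>))
    \<le> exp (t * expectation Y + t\<^sup>2 * exp (t * y) * expectation (\<lambda>\<omega>. (Y \<omega>)\<^sup>2))"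
proof -
  have i1: "integrable M Y"
    by (rule integrable_const_bound[where B=y]) (use bd in auto)
  have i2: "integrable M (\<lambda>\<omega>. (Y \<omega>)\<^sup>2)"
    by (rule integrable_const_bound[where B="y\<^sup>2"])
       (use power_mono[OF bd abs_ge_zero, of _ 2] in auto)
  have i3: "integrable M (\<lambda>\<omega>. exp (t * Y \<omega>))"
  proof (rule integrable_const_bound[where B="exp (t * y)"])
    show "AE x in M. norm (exp (t * Y x)) \<le> exp (t * y)"
      using bd t by (auto intro!: AE_I2 mult_left_mono dest: abs_le_D1)
  qed simp
  have "expectation (\<lambda>\<omega>. exp (t * Y \<omega>))
      \<le> expectation (\<lambda>\<omega>. 1 + t * Y \<omega> + t\<^sup>2 * exp (t * y) * (Y \<omega>)\<^sup>2)"
  proof (rule integral_mono[OF i3])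
    show "integrable M (\<lambda>\<omega>. 1 + t * Y \<omega> + t\<^sup>2 * exp (t * y) * (Y \<omega>)\<^sup>2)"
      using i1 i2 by simp
    fix \<omega> assume "\<omega> \<in> space M"
    then have "\<bar>t * Y \<omega>\<bar> \<le> t * y"
      using bd t by (simp add: abs_mult mult_left_mono)
    from exp_le_quadratic[OF this]
    show "exp (t * Y \<omega>) \<le> 1 + t * Y \<omega> + t\<^sup>2 * exp (t * y) * (Y \<omega>)\<^sup>2"
      by (simp add: power_mult_distrib mult_ac)
  qed
  also have "\<dots> = 1 + (t * expectation Y + t\<^sup>2 * exp (t * y) * expectation (\<lambda>\<omega>. (Y \<omega>)\<^sup>2))"
    using i1 i2 by (simp add: prob_space)
  also have "\<dots> \<le> exp (t * expectation Y + t\<^sup>2 * exp (t * y) * expectation (\<lambda>\<omega>. (Y \<omega>)\<^sup>2))"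
    by (rule exp_ge_add_one_self)
  finally show ?thesis .
qed

text \<open>Chernoff's method with the exponent \<open>t\<close> left free, since it will later grow
  logarithmically relative to \<open>1 / y\<close>. The mean is bounded from above only, so that the
  estimate can serve both \<open>Y\<close> and its negative.\<close>

lemma prob_sum_ge_le:
  fixes Y :: "'i \<Rightarrow> 'a \<Rightarrow> real" and y t :: real
  assumes ind: "indep_vars (\<lambda>_. borel) Y I" and fin: "finite I"
    and bd: "\<And>i \<omega>. i \<in> I \<Longrightarrow> \<omega> \<in> space M \<Longrightarrow> \<bar>Y i \<omega>\<bar> \<le> y"
    and m: "\<And>i. i \<in> I \<Longrightarrow> expectation (Y i) \<le> m"
    and s: "\<And>i. i \<in> I \<Longrightarrow> expectation (\<lambda>\<omega>. (Y i \<omega>)\<^sup>2) \<le> s"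
    and t: "0 < t"
  shows "prob {\<omega> \<in> space M. x \<le> (\<Sum>i\<in>I. Y i \<omega>)}
    \<le> exp (- t * x + card I * (t * m + t\<^sup>2 * exp (t * y) * s))"
proof -
  have rv: "random_variable borel (Y i)" if "i \<in> I" for i
    using ind that by (auto simp: indep_vars_def)
  have ind': "indep_vars (\<lambda>_. borel) (\<lambda>i \<omega>. exp (t * Y i \<omega>)) I"
    by (rule indep_vars_compose2[OF ind]) simp
  have int: "integrable M (\<lambda>\<omega>. exp (t * Y i \<omega>))" if "i \<in> I" for i
  proof (rule integrable_const_bound[where B="exp (t * y)"])
    show "AE x in M. norm (exp (t * Y i x)) \<le> exp (t * y)"
      using bd[OF that] t by (auto intro!: AE_I2 dest: abs_le_D1)
  qed (use rv[OF that] in measurable)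
  have e: "exp (t * (\<Sum>i\<in>I. Y i \<omega>)) = (\<Prod>i\<in>I. exp (t * Y i \<omega>))" for \<omega>
    by (simp add: sum_distrib_left exp_sum fin)
  have "integrable M (\<lambda>\<omega>. \<Prod>i\<in>I. exp (t * Y i \<omega>))"
    by (rule indep_vars_integrable[OF fin ind' int])
  then have "prob {\<omega> \<in> space M. (\<Sum>i\<in>I. Y i \<omega>) \<ge> x}
      \<le> exp (- t * x) * (\<integral>\<omega>\<in>space M. exp (t * (\<Sum>i\<in>I. Y i \<omega>)) \<partial>M)"
    by (intro Chernoff_ineq_ge t)
       (simp_all add: set_integrable_def e integrable_mult_indicator del: real_scaleR_def)
  also have "(\<integral>\<omega>\<in>space M. exp (t * (\<Sum>i\<in>I. Y i \<omega>)) \<partial>M) = (\<integral>\<omega>. (\<Prod>i\<in>I. exp (t * Y i \<omega>)) \<partial>M)"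
    unfolding e by (rule set_integral_space[OF \<open>integrable M _\<close>])
  also have "\<dots> = (\<Prod>i\<in>I. expectation (\<lambda>\<omega>. exp (t * Y i \<omega>)))"
    by (rule indep_vars_lebesgue_integral[OF fin ind' int])
  also have "\<dots> \<le> (\<Prod>i\<in>I. exp (t * m + t\<^sup>2 * exp (t * y) * s))"
  proof (rule prod_mono, intro conjI)
    fix i assume i: "i \<in> I"
    show "0 \<le> expectation (\<lambda>\<omega>. exp (t * Y i \<omega>))"
      by simp
    have "expectation (\<lambda>\<omega>. exp (t * Y i \<omega>))
        \<le> exp (t * expectation (Y i) + t\<^sup>2 * exp (t * y) * expectation (\<lambda>\<omega>. (Y i \<omega>)\<^sup>2))"
      by (rule expectation_exp_le[OF rv[OF i] bd[OF i]]) (use t in auto)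
    also have "\<dots> \<le> exp (t * m + t\<^sup>2 * exp (t * y) * s)"
      using m[OF i] s[OF i] t by (auto intro!: add_mono mult_left_mono)
    finally show "expectation (\<lambda>\<omega>. exp (t * Y i \<omega>)) \<le> exp (t * m + t\<^sup>2 * exp (t * y) * s)" .
  qed
  also have "exp (- t * x) * (\<Prod>i\<in>I. exp (t * m + t\<^sup>2 * exp (t * y) * s))
      = exp (- t * x + card I * (t * m + t\<^sup>2 * exp (t * y) * s))"
    by (simp only: exp_add exp_of_nat_mult prod_constant)
  finally show ?thesis by simp
qed

lemma prob_abs_sum_ge_le:
  fixes Y :: "'i \<Rightarrow> 'a \<Rightarrow> real" and y t :: real
  assumes ind: "indep_vars (\<lambda>_. borel) Y I" and fin: "finite I"
    and bd: "\<And>i \<omega>. i \<in> I \<Longrightarrow> \<omega> \<in> space M \<Longrightarrow> \<bar>Y i \<omega>\<bar> \<le> y"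
    and m: "\<And>i. i \<in> I \<Longrightarrow> \<bar>expectation (Y i)\<bar> \<le> m"
    and s: "\<And>i. i \<in> I \<Longrightarrow> expectation (\<lambda>\<omega>. (Y i \<omega>)\<^sup>2) \<le> s"
    and t: "0 < t"
  shows "prob {\<omega> \<in> space M. x \<le> \<bar>\<Sum>i\<in>I. Y i \<omega>\<bar>}
    \<le> 2 * exp (- t * x + card I * (t * m + t\<^sup>2 * exp (t * y) * s))"
proof -
  have [measurable]: "random_variable borel (Y i)" if "i \<in> I" for i
    using ind that by (auto simp: indep_vars_def)
  have ind': "indep_vars (\<lambda>_. borel) (\<lambda>i \<omega>. - Y i \<omega>) I"
    by (rule indep_vars_compose2[OF ind]) simp
  let ?A = "{\<omega> \<in> space M. x \<le> (\<Sum>i\<in>I. Y i \<omega>)}"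
  let ?B = "{\<omega> \<in> space M. x \<le> (\<Sum>i\<in>I. - Y i \<omega>)}"
  have "prob {\<omega> \<in> space M. x \<le> \<bar>\<Sum>i\<in>I. Y i \<omega>\<bar>} \<le> prob (?A \<union> ?B)"
    by (rule finite_measure_mono) (auto simp: sum_negf abs_if split: if_splits)
  also have "\<dots> \<le> prob ?A + prob ?B"
    by (rule measure_Un_le) auto
  also have "prob ?A \<le> exp (- t * x + card I * (t * m + t\<^sup>2 * exp (t * y) * s))"
    by (rule prob_sum_ge_le[OF ind fin bd _ s t]) (use m in \<open>auto dest: abs_le_D1\<close>)
  also have "prob ?B \<le> exp (- t * x + card I * (t * m + t\<^sup>2 * exp (t * y) * s))"
    by (rule prob_sum_ge_le[OF ind' fin]) (use m bd s t in \<open>auto dest: abs_le_D2\<close>)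
  finally show ?thesis by simp
qed

section \<open>Converse Borel-Cantelli, orthogonality, and second moments from tails\<close>

text \<open>Almost every point lies in some \<open>B N\<close>, so one \<open>B N\<close> has
  positive probability. By independence this probability is at most the product of the
  \<open>1 - prob (A n)\<close> over any finite range from \<open>N\<close> on, hence at most
  \<open>exp\<close> of minus the sum. So \<open>- ln (prob (B N))\<close> bounds all partial sums
  from \<open>N\<close> on.\<close>

lemma borel_cantelli_converse:
  fixes P :: "nat \<Rightarrow> 'a \<Rightarrow> bool"
  assumes ind: "indep_vars (\<lambda>_. count_space UNIV) P UNIV"
    and fin: "AE \<omega> in M. \<forall>\<^sub>F n in sequentially. \<not> P n \<omega>"
  shows "summable (\<lambda>n. prob {\<omega> \<in> space M. P n \<omega>})"
proof -
  define A where "A n = {\<omega> \<in> space M. P n \<omega>}" for n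
  have [measurable]: "Measurable.pred M (P n)" for n
    using ind by (auto simp: indep_vars_def)
  have meas [measurable]: "A n \<in> events" for n
    unfolding A_def by measurable
  define B where "B N = {\<omega> \<in> space M. \<forall>n\<ge>N. \<omega> \<notin> A n}" for N
  have [measurable]: "B N \<in> events" for N
    unfolding B_def by measurable
  have "\<exists>N. prob (B N) > 0"
  proof (rule ccontr)
    assume "\<not> (\<exists>N. prob (B N) > 0)"
    then have "prob (B N) = 0" for N
      by (metis measure_nonneg order_le_less)
    then have "AE \<omega> in M. \<forall>N. \<omega> \<notin> B N"
      by (subst AE_all_countable) (auto simp: prob_eq_0[symmetric])
    with fin have "AE \<omega> in M. False"
      using AE_space by eventually_elim (auto simp: B_def A_def eventually_sequentially)
    then show False by simp
  qed
  then obtain N where N: "prob (B N) > 0" by blast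
  have bound: "(\<Sum>n\<in>{N..<K}. prob (A n)) \<le> - ln (prob (B N))" if "N < K" for K
  proof -
    have vim: "P n -` {False} \<inter> space M = space M - A n" for n
      by (auto simp: A_def)
    have "prob (B N) \<le> prob (\<Inter>n\<in>{N..<K}. P n -` {False} \<inter> space M)"
      unfolding vim by (rule finite_measure_mono, force simp: B_def)
        (rule sets.finite_INT, use that in auto)
    also have "\<dots> = (\<Prod>n\<in>{N..<K}. prob (P n -` {False} \<inter> space M))"
      by (rule indep_varsD[OF ind]) (use that in auto)
    also have "\<dots> = (\<Prod>n\<in>{N..<K}. 1 - prob (A n))"
      by (simp only: vim prob_compl[OF meas])
    also have "\<dots> \<le> (\<Prod>n\<in>{N..<K}. exp (- prob (A n)))"
      by (intro prod_mono conjI) (use exp_ge_add_one_self[of "- prob (A _)"] in auto)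
    also have "\<dots> = exp (- (\<Sum>n\<in>{N..<K}. prob (A n)))"
      by (simp add: exp_sum sum_negf[symmetric])
    finally have "ln (prob (B N)) \<le> - (\<Sum>n\<in>{N..<K}. prob (A n))"
      using N by (metis ln_exp ln_mono exp_gt_zero)
    then show ?thesis by simp
  qed
  have "summable (\<lambda>n. prob (A (n + N)))"
  proof (rule summableI_nonneg_bounded)
    fix n
    have "(\<Sum>i<n. prob (A (i + N))) = (\<Sum>i\<in>{N..<N+n}. prob (A i))"
      by (rule sum.reindex_bij_witness[of _ "\<lambda>i. i - N" "\<lambda>i. i + N"]) auto
    also have "\<dots> \<le> (\<Sum>i\<in>{N..<N+n+1}. prob (A i))"
      by (rule sum_mono2) auto
    also have "\<dots> \<le> - ln (prob (B N))"
      using bound[of "N + n + 1"] by simp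
    finally show "(\<Sum>i<n. prob (A (i + N))) \<le> - ln (prob (B N))" .
  qed simp
  then have "summable (\<lambda>n. prob (A n))"
    by (rule summable_iff_shift[THEN iffD1])
  then show ?thesis
    by (simp only: A_def)
qed

text \<open>The mixed terms vanish by independence and centring. Only second moments enter, which is
  all that is known about the products when the mean is to be determined.\<close>

lemma expectation_sum_square:
  fixes V :: "'i \<Rightarrow> 'a \<Rightarrow> real"
  assumes ind: "indep_vars (\<lambda>_. borel) V I" and fin: "finite I"
    and int: "\<And>i. i \<in> I \<Longrightarrow> integrable M (\<lambda>\<omega>. (V i \<omega>)\<^sup>2)"
    and zero: "\<And>i. i \<in> I \<Longrightarrow> expectation (V i) = 0"
  shows "integrable M (\<lambda>\<omega>. (\<Sum>i\<in>I. V i \<omega>)\<^sup>2)"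
    and "expectation (\<lambda>\<omega>. (\<Sum>i\<in>I. V i \<omega>)\<^sup>2) = (\<Sum>i\<in>I. expectation (\<lambda>\<omega>. (V i \<omega>)\<^sup>2))"
proof -
  have int1: "integrable M (V i)" if "i \<in> I" for i
  proof (rule square_integrable_imp_integrable[OF _ int[OF that]])
    show "random_variable borel (V i)"
      using ind that unfolding indep_vars_def by blast
  qed
  have eq: "(\<Sum>i\<in>I. V i \<omega>)\<^sup>2 = (\<Sum>i\<in>I. \<Sum>j\<in>I. V i \<omega> * V j \<omega>)" for \<omega>
    by (simp add: power2_eq_square sum_product)
  have prod: "integrable M (\<lambda>\<omega>. V i \<omega> * V j \<omega>) \<and>
      expectation (\<lambda>\<omega>. V i \<omega> * V j \<omega>) = (if i = j then expectation (\<lambda>\<omega>. (V i \<omega>)\<^sup>2) else 0)"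
    if ij: "i \<in> I" "j \<in> I" for i j
  proof (cases "i = j")
    case True
    then show ?thesis
      using int[OF ij(1)] by (simp add: power2_eq_square)
  next
    case False
    have "indep_vars (\<lambda>_. borel) V {i, j}"
      by (rule indep_vars_subset[OF ind]) (use ij in auto)
    note * = indep_vars_lebesgue_integral[OF _ this int1] indep_vars_integrable[OF _ this int1]
    have "expectation (\<lambda>\<omega>. \<Prod>k\<in>{i, j}. V k \<omega>) = (\<Prod>k\<in>{i, j}. expectation (V k))"
      by (rule *(1)) (use ij in auto)
    moreover have "integrable M (\<lambda>\<omega>. \<Prod>k\<in>{i, j}. V k \<omega>)"
      by (rule *(2)) (use ij in auto)
    ultimately show ?thesis
      using False zero[OF ij(1)] by simp
  qed
  show "integrable M (\<lambda>\<omega>. (\<Sum>i\<in>I. V i \<omega>)\<^sup>2)"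
    unfolding eq by (intro Bochner_Integration.integrable_sum) (use prod in blast)
  have "expectation (\<lambda>\<omega>. (\<Sum>i\<in>I. V i \<omega>)\<^sup>2) = (\<Sum>i\<in>I. \<Sum>j\<in>I. expectation (\<lambda>\<omega>. V i \<omega> * V j \<omega>))"
    unfolding eq
    by (subst Bochner_Integration.integral_sum,
        (intro Bochner_Integration.integrable_sum; use prod in blast),
        intro sum.cong refl Bochner_Integration.integral_sum, use prod in blast)
  also have "\<dots> = (\<Sum>i\<in>I. \<Sum>j\<in>I. if i = j then expectation (\<lambda>\<omega>. (V i \<omega>)\<^sup>2) else 0)"
    by (intro sum.cong refl) (use prod in blast)
  also have "\<dots> = (\<Sum>i\<in>I. expectation (\<lambda>\<omega>. (V i \<omega>)\<^sup>2))"
    using fin by simp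
  finally show "expectation (\<lambda>\<omega>. (\<Sum>i\<in>I. V i \<omega>)\<^sup>2) = (\<Sum>i\<in>I. expectation (\<lambda>\<omega>. (V i \<omega>)\<^sup>2))" .
qed

text \<open>Discrete layer-cake formula: with k the integer part of z, z squared is at most (k + 1)
  squared, which is the sum of the odd numbers 2 n + 1 over n \<le> k, that is, over all n \<le> z.
  For n \<ge> 1 these weights are at most 3 n.\<close>

lemma nn_integral_square_finite:
  fixes Z :: "'a \<Rightarrow> real"
  assumes [measurable]: "random_variable borel Z" and nonneg: "\<And>\<omega>. 0 \<le> Z \<omega>"
    and sum: "summable (\<lambda>n. real n * prob {\<omega> \<in> space M. real n \<le> Z \<omega>})"
  shows "(\<integral>\<^sup>+\<omega>. ennreal ((Z \<omega>)\<^sup>2) \<partial>M) < \<infinity>"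
proof -
  let ?P = "\<lambda>n. prob {\<omega> \<in> space M. real n \<le> Z \<omega>}"
  have le: "ennreal (z\<^sup>2) \<le> (\<Sum>n. ennreal (2 * real n + 1) * indicator {n. real n \<le> z} n)"
    if "0 \<le> z" for z :: real
  proof -
    define k where "k = nat \<lfloor>z\<rfloor>"
    have k: "real k \<le> z" "z \<le> real k + 1"
      using that unfolding k_def by linarith+
    have "z\<^sup>2 \<le> (real k + 1)\<^sup>2"
      using k that by (intro power_mono) auto
    also have "\<dots> = (\<Sum>n<Suc k. 2 * real n + 1)"
      by (induction k) (auto simp: power2_eq_square algebra_simps)
    finally have "ennreal (z\<^sup>2) \<le> ennreal (\<Sum>n<Suc k. 2 * real n + 1)"
      by (rule ennreal_leI)
    also have "\<dots> = (\<Sum>n<Suc k. ennreal (2 * real n + 1))"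
      by (rule sum_ennreal[symmetric]) auto
    also have "\<dots> = (\<Sum>n<Suc k. ennreal (2 * real n + 1) * indicator {n. real n \<le> z} n)"
      using k by (intro sum.cong) auto
    also have "\<dots> \<le> (\<Sum>n. ennreal (2 * real n + 1) * indicator {n. real n \<le> z} n)"
      by (rule sum_le_suminf) auto
    finally show ?thesis .
  qed
  have s: "summable (\<lambda>n. (2 * real n + 1) * ?P n)"
  proof (rule summable_comparison_test_ev)
    show "\<forall>\<^sub>F n in sequentially. norm ((2 * real n + 1) * ?P n) \<le> 3 * (real n * ?P n)"
      using eventually_ge_at_top[of 1]
    proof eventually_elim
      case (elim n)
      then show ?case
        using mult_right_mono[of "2 * real n + 1" "3 * real n" "?P n"] by (simp add: abs_mult)
    qed
    show "summable (\<lambda>n. 3 * (real n * ?P n))" by (rule summable_mult[OF sum])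
  qed
  have "(\<integral>\<^sup>+\<omega>. ennreal ((Z \<omega>)\<^sup>2) \<partial>M)
      \<le> (\<integral>\<^sup>+\<omega>. (\<Sum>n. ennreal (2 * real n + 1) * indicator {\<omega>\<in>space M. real n \<le> Z \<omega>} \<omega>) \<partial>M)"
    by (rule nn_integral_mono) (use le[OF nonneg] in \<open>auto simp: indicator_def\<close>)
  also have "\<dots> = (\<Sum>n. ennreal (2 * real n + 1) * emeasure M {\<omega>\<in>space M. real n \<le> Z \<omega>})"
    by (subst nn_integral_suminf) (auto simp: nn_integral_cmult)
  also have "\<dots> = (\<Sum>n. ennreal ((2 * real n + 1) * ?P n))"
    by (simp add: emeasure_eq_measure ennreal_mult)
  also have "\<dots> = ennreal (\<Sum>n. (2 * real n + 1) * ?P n)"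
    by (rule suminf_ennreal2) (auto simp: s)
  also have "\<dots> < \<infinity>" by simp
  finally show ?thesis .
qed

end

section \<open>Truncation and elementary inequalities\<close>

text \<open>Large values are replaced by 0 rather than clipped, so that the discarded part is either
  0 or all of \<open>z\<close>. The strict inequality is the complement of the event that
  \<open>z\<close> reaches the level.\<close>

definition trunc :: "real \<Rightarrow> real \<Rightarrow> real" where
  "trunc y z = (if \<bar>z\<bar> < y then z else 0)"

lemma measurable_trunc [measurable]: "trunc y \<in> borel_measurable borel"
  unfolding trunc_def by measurable

lemma abs_trunc_le: "0 \<le> y \<Longrightarrow> \<bar>trunc y z\<bar> \<le> y"
  by (auto simp: trunc_def)

text \<open>Interpolation: below the level \<open>y\<close>, surplus powers of \<open>z\<close> can
  be traded for powers of \<open>y\<close>. The truncation bounds that follow use this to express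
  means and second moments through one available moment of order \<open>r\<close>.\<close>

lemma powr_split_le:
  fixes z y r s :: real
  assumes "0 \<le> z" "z \<le> y" "0 < y" "r \<le> s" "0 < r"
  shows "z powr s \<le> y powr (s - r) * z powr r"
proof -
  have "z powr s = z powr (s - r) * z powr r"
    by (simp add: powr_add[symmetric])
  also have "\<dots> \<le> y powr (s - r) * z powr r"
    using assms by (intro mult_right_mono powr_mono2) auto
  finally show ?thesis .
qed

lemma abs_trunc_le_powr:
  assumes "0 < r" "r \<le> 1" "0 < y"
  shows "\<bar>trunc y z\<bar> \<le> y powr (1 - r) * \<bar>z\<bar> powr r"
  using powr_split_le[of "\<bar>z\<bar>" y r 1] assms by (auto simp: trunc_def)

lemma trunc_square_le_powr:
  assumes "0 < r" "r \<le> 2" "0 < y"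
  shows "(trunc y z)\<^sup>2 \<le> y powr (2 - r) * \<bar>z\<bar> powr r"
  using powr_split_le[of "\<bar>z\<bar>" y r 2] assms by (auto simp: trunc_def powr_numeral)

lemma abs_diff_trunc_le_powr:
  assumes "1 \<le> r" "0 < y"
  shows "\<bar>z - trunc y z\<bar> \<le> y powr (1 - r) * \<bar>z\<bar> powr r"
proof (cases "\<bar>z\<bar> < y")
  case False
  then have "\<bar>z\<bar> = \<bar>z\<bar> powr (1 - r) * \<bar>z\<bar> powr r"
    using assms by (simp add: powr_add[symmetric])
  also have "\<dots> \<le> y powr (1 - r) * \<bar>z\<bar> powr r"
    using False assms by (intro mult_right_mono powr_mono2') auto
  finally show ?thesis using False by (simp add: trunc_def)
qed (simp add: trunc_def)

text \<open>Bernoulli's inequality applied to 1 + h. The rational bound, in place of an exponential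
  one, can later be solved for \<open>m * h\<close> by plain algebra.\<close>

lemma one_minus_power_le:
  fixes h :: real
  assumes "0 \<le> h" "h \<le> 1"
  shows "(1 - h) ^ m \<le> 1 / (1 + real m * h)"
proof -
  have "(1 - h) * (1 + h) \<le> 1"
    by (simp add: algebra_simps)
  then have "1 - h \<le> 1 / (1 + h)"
    using assms by (simp add: field_simps)
  then have "(1 - h) ^ m \<le> (1 / (1 + h)) ^ m"
    using assms by (intro power_mono) auto
  also have "\<dots> = 1 / (1 + h) ^ m"
    by (simp add: power_one_over)
  also have "\<dots> \<le> 1 / (1 + real m * h)"
    using Bernoulli_inequality[of h m] assms
    by (intro divide_left_mono mult_pos_pos add_pos_nonneg) auto
  finally show ?thesis .
qed

subsection \<open>Arrays of independent identically distributed entries\<close>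

locale iid_array = prob_space M for M :: "'a measure" +
  fixes X :: "nat \<Rightarrow> nat \<Rightarrow> 'a \<Rightarrow> real"
  assumes indep: "indep_vars (\<lambda>_. borel) (\<lambda>(k, i). X k i) ({1..} \<times> {1..})"
    and ident: "\<And>k i. 1 \<le> k \<Longrightarrow> 1 \<le> i \<Longrightarrow> distr M borel (X k i) = distr M borel (X 1 1)"
begin

abbreviation "idx \<equiv> {1::nat..} \<times> {1::nat..}"

lemma rv: "1 \<le> k \<Longrightarrow> 1 \<le> i \<Longrightarrow> random_variable borel (X k i)"
  using indep by (auto simp: indep_vars_def)

lemma rv_case: "u \<in> idx \<Longrightarrow> random_variable borel (case_prod X u)"
  using rv by (cases u) auto

lemma distr_case: "u \<in> idx \<Longrightarrow> distr M borel (case_prod X u) = distr M borel (X 1 1)"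
  using ident[of "fst u" "snd u"] by (simp add: case_prod_unfold mem_Times_iff)

lemma indep_reindex:
  assumes "inj_on g J" "g ` J \<subseteq> idx"
  shows "indep_vars (\<lambda>_. borel) (\<lambda>j. case_prod X (g j)) J"
proof -
  have "indep_vars (\<lambda>j. PiM {g j} (\<lambda>_. borel)) (\<lambda>j \<omega>. restrict (\<lambda>u. case_prod X u \<omega>) {g j}) J"
    using assms by (intro indep_vars_restrict[OF indep])
      (auto simp: disjoint_family_on_def inj_on_def)
  then have "indep_vars (\<lambda>_. borel)
      (\<lambda>j \<omega>. (\<lambda>v. v (g j)) (restrict (\<lambda>u. case_prod X u \<omega>) {g j})) J"
    by (rule indep_vars_compose2) (simp add: measurable_component_singleton)
  then show ?thesis by simp
qed

text \<open>Products over disjoint pairs of positions are functions of disjoint groups of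
  independent entries. It serves in two directions: for disjoint column pairs within one row, and
  for a fixed column pair down the rows.\<close>

lemma indep_products:
  assumes "\<And>j. j \<in> J \<Longrightarrow> u j \<in> idx" "\<And>j. j \<in> J \<Longrightarrow> v j \<in> idx"
    and "disjoint_family_on (\<lambda>j. {u j, v j}) J"
  shows "indep_vars (\<lambda>_. borel) (\<lambda>j \<omega>. case_prod X (u j) \<omega> * case_prod X (v j) \<omega>) J"
proof -
  have "indep_vars (\<lambda>j. PiM {u j, v j} (\<lambda>_. borel))
      (\<lambda>j \<omega>. restrict (\<lambda>w. case_prod X w \<omega>) {u j, v j}) J"
    using assms by (intro indep_vars_restrict[OF indep]) auto
  then have "indep_vars (\<lambda>_. borel)
      (\<lambda>j \<omega>. (\<lambda>f. f (u j) * f (v j)) (restrict (\<lambda>w. case_prod X w \<omega>) {u j, v j})) J"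
    by (rule indep_vars_compose2)
       (intro borel_measurable_times measurable_component_singleton, auto)
  then show ?thesis by simp
qed

lemma indep_pair:
  assumes "u \<in> idx" "v \<in> idx" "u \<noteq> v"
  shows "indep_var borel (case_prod X u) borel (case_prod X v)"
proof -
  have "indep_vars (\<lambda>_. borel) (\<lambda>b. case_prod X (case_bool u v b)) UNIV"
    using assms by (intro indep_reindex) (auto simp: inj_on_def split: bool.splits)
  moreover have "(\<lambda>b. case_prod X (case_bool u v b)) = case_bool (case_prod X u) (case_prod X v)"
    by (auto simp: fun_eq_iff split: bool.splits)
  moreover have "(\<lambda>_. borel) = case_bool borel (borel :: real measure)"
    by (auto simp: fun_eq_iff split: bool.splits)
  ultimately show ?thesis
    unfolding indep_var_def by simp
qed

text \<open>Two distinct entries have the product of the common law with itself as joint law,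
  whatever their positions. Hence every moment of an entry product can be computed on the entries
  \<open>X 1 1\<close> and \<open>X 1 2\<close>.\<close>

lemma distr_product:
  assumes "u \<in> idx" "v \<in> idx" "u \<noteq> v"
  shows "distr M borel (\<lambda>\<omega>. case_prod X u \<omega> * case_prod X v \<omega>)
    = distr M borel (\<lambda>\<omega>. X 1 1 \<omega> * X 1 2 \<omega>)"
proof -
  have *: "distr M borel (\<lambda>\<omega>. case_prod X u \<omega> * case_prod X v \<omega>)
      = distr (distr M borel (X 1 1) \<Otimes>\<^sub>M distr M borel (X 1 1)) borel (\<lambda>(a, b). a * b)"
    if uv: "u \<in> idx" "v \<in> idx" "u \<noteq> v" for u v
  proof -
    have [measurable]: "random_variable borel (case_prod X u)" "random_variable borel (case_prod X v)"
      using uv rv_case by blast+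
    have "distr M borel (X 1 1) \<Otimes>\<^sub>M distr M borel (X 1 1)
        = distr M (borel \<Otimes>\<^sub>M borel) (\<lambda>\<omega>. (case_prod X u \<omega>, case_prod X v \<omega>))"
      using indep_pair[OF uv] distr_case[of u] distr_case[of v] uv
      unfolding indep_var_distribution_eq by simp
    then show ?thesis
      by (simp add: distr_distr comp_def)
  qed
  show ?thesis
    using *[OF assms] *[of "(1, 1)" "(1, 2)"] by simp
qed

section \<open>The probability of a large product within one row\<close>

text \<open>Row and column set are arbitrary, so that blocks of columns and shifted rows can be
  compared with the first row. The condition \<open>i \<noteq> j\<close> in place of an order makes
  the event invariant under relabelling of the columns.\<close>

definition big :: "nat \<Rightarrow> nat set \<Rightarrow> real \<Rightarrow> 'a set" where
  "big r A x = {\<omega> \<in> space M. \<exists>i\<in>A. \<exists>j\<in>A. i \<noteq> j \<and> x \<le> \<bar>X r i \<omega> * X r j \<omega>\<bar>}"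

abbreviation q :: "nat \<Rightarrow> real \<Rightarrow> real" where
  "q n x \<equiv> prob (big 1 {1..n} x)"

lemma big_sets: "1 \<le> r \<Longrightarrow> A \<subseteq> {1..} \<Longrightarrow> big r A x \<in> events"
proof -
  assume r: "1 \<le> r" "A \<subseteq> {1..}"
  have [measurable]: "random_variable borel (X r i)" if "i \<in> A" for i
    using r that rv by auto
  have "countable A" by simp
  then show ?thesis
    unfolding big_def by measurable
qed

lemma big_mono:
  assumes "A \<subseteq> B" "y \<le> x"
  shows "big r A x \<subseteq> big r B y"
  using assms(1) order_trans[OF assms(2)] unfolding big_def by blast

text \<open>A bijection from \<open>{1..n}\<close> onto the column set turns the event into the
  preimage of one fixed set \<open>S\<close> under a vector with \<open>n\<close> i.i.d. components.
  Its probability therefore depends on the number of columns alone.\<close>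

lemma prob_big_eq:
  assumes r: "1 \<le> r" and A: "A \<subseteq> {1..}" "finite A"
  shows "prob (big r A x) = q (card A) x"
proof (cases "A = {}")
  case False
  define n where "n = card A"
  have n: "n \<ge> 1"
    using False A by (simp add: n_def Suc_le_eq card_gt_0_iff)
  let ?P = "PiM {1..n} (\<lambda>_. borel :: real measure)"
  define S where "S = {v \<in> space ?P. \<exists>i\<in>{1..n}. \<exists>j\<in>{1..n}. i \<noteq> j \<and> x \<le> \<bar>v i * v j\<bar>}"
  have S: "S \<in> sets ?P"
    unfolding S_def by measurable
  have *: "prob (big r B x) = measure (PiM {1..n} (\<lambda>_. distr M borel (X 1 1))) S"
    if B: "B \<subseteq> {1..}" "bij_betw g {1..n} B" and r: "1 \<le> r" for B g r
  proof -
    have gB: "g ` {1..n} = B" "inj_on g {1..n}"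
      using B by (auto simp: bij_betw_def)
    have g1: "1 \<le> g i" if "i \<in> {1..n}" for i
    proof -
      have "g i \<in> B" using gB(1) that by blast
      then show ?thesis using B(1) by auto
    qed
    have rvg: "random_variable borel (X r (g i))" if "i \<in> {1..n}" for i
      using rv[OF r g1[OF that]] .
    have T: "(\<lambda>\<omega>. \<lambda>i\<in>{1..n}. X r (g i) \<omega>) \<in> measurable M ?P"
      by (rule measurable_restrict) (rule rvg)
    have "indep_vars (\<lambda>_. borel) (\<lambda>i. case_prod X (r, g i)) {1..n}"
    proof (rule indep_reindex)
      show "inj_on (\<lambda>i. (r, g i)) {1..n}"
        using gB(2) unfolding inj_on_def prod.inject by blast
      show "(\<lambda>i. (r, g i)) ` {1..n} \<subseteq> idx"
        unfolding image_subset_iff mem_Times_iff fst_conv snd_conv atLeast_iff using r g1 by blast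
    qed
    then have ind: "indep_vars (\<lambda>_. borel) (\<lambda>i. X r (g i)) {1..n}" by simp
    have "distr M ?P (\<lambda>\<omega>. \<lambda>i\<in>{1..n}. X r (g i) \<omega>) = PiM {1..n} (\<lambda>i. distr M borel (X r (g i)))"
      using n ind by (subst indep_vars_iff_distr_eq_PiM'[symmetric]) (auto simp: rvg)
    also have "\<dots> = PiM {1..n} (\<lambda>_. distr M borel (X 1 1))"
      by (rule PiM_cong) (use ident[OF r g1] in auto)
    finally have d: "distr M ?P (\<lambda>\<omega>. \<lambda>i\<in>{1..n}. X r (g i) \<omega>) = PiM {1..n} (\<lambda>_. distr M borel (X 1 1))" .
    have "big r B x = (\<lambda>\<omega>. \<lambda>i\<in>{1..n}. X r (g i) \<omega>) -` S \<inter> space M"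
    proof (intro set_eqI iffI)
      fix \<omega> assume "\<omega> \<in> big r B x"
      then obtain i j where ij: "i \<in> {1..n}" "j \<in> {1..n}" "g i \<noteq> g j"
        "x \<le> \<bar>X r (g i) \<omega> * X r (g j) \<omega>\<bar>" and \<omega>: "\<omega> \<in> space M"
        unfolding big_def gB(1)[symmetric] by blast
      let ?v = "\<lambda>i\<in>{1..n}. X r (g i) \<omega>"
      have "\<exists>i\<in>{1..n}. \<exists>j\<in>{1..n}. i \<noteq> j \<and> x \<le> \<bar>?v i * ?v j\<bar>"
        by (rule bexI[OF _ ij(1)], rule bexI[OF _ ij(2)]) (use ij in auto)
      then show "\<omega> \<in> (\<lambda>\<omega>. \<lambda>i\<in>{1..n}. X r (g i) \<omega>) -` S \<inter> space M"
        using measurable_space[OF T \<omega>] \<omega> by (simp add: S_def)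
    next
      fix \<omega> assume "\<omega> \<in> (\<lambda>\<omega>. \<lambda>i\<in>{1..n}. X r (g i) \<omega>) -` S \<inter> space M"
      then obtain i j where ij: "i \<in> {1..n}" "j \<in> {1..n}" "i \<noteq> j"
        "x \<le> \<bar>X r (g i) \<omega> * X r (g j) \<omega>\<bar>" "\<omega> \<in> space M"
        unfolding S_def by auto
      moreover have "g i \<noteq> g j"
        using ij inj_onD[OF gB(2)] by blast
      ultimately show "\<omega> \<in> big r B x"
        unfolding big_def gB(1)[symmetric] by blast
    qed
    then have "prob (big r B x) = measure (distr M ?P (\<lambda>\<omega>. \<lambda>i\<in>{1..n}. X r (g i) \<omega>)) S"
      by (simp only: measure_distr[OF T S])
    then show ?thesis by (simp only: d)
  qed
  obtain g where g: "bij_betw g {1..n} A"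
    using ex_bij_betw_nat_finite_1[OF A(2)] n_def by blast
  show ?thesis
    using *[OF A(1) g r] *[of "{1..n}" id 1] by (simp add: n_def)
qed (simp add: big_def)

lemma prob_big_le:
  assumes r: "1 \<le> r" and A: "A \<subseteq> {1..}" "finite A" "card A \<le> m"
  shows "prob (big r A x) \<le> q m x"
  unfolding prob_big_eq[OF assms(1-3)]
  by (rule finite_measure_mono[OF big_mono[OF _ order_refl] big_sets]) (use A in auto)

text \<open>Cut the \<open>D\<close> columns into \<open>3 * R\<close> blocks of length \<open>m div 2\<close>: any two columns lie in a union of
  two blocks, which has at most \<open>m\<close> columns.\<close>

lemma q_scale_le:
  assumes m: "2 \<le> m" and D: "D \<le> R * m"
  shows "q D x \<le> 9 * (real R)\<^sup>2 * q m x"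
proof -
  define l where "l = m div 2"
  \<comment> \<open>The worst case of the last inequality is m = 3, where l = 1. It gives D \<le> 3
    R l, so that \<open>3 * R\<close> blocks cover all columns and the factor 9 counts ordered pairs
    of blocks.\<close>
  have l: "1 \<le> l" "2 * l \<le> m" "m \<le> 3 * l"
    using m unfolding l_def by presburger+
  define B where "B a = {a * l + 1 .. a * l + l}" for a
  have sub: "big 1 {1..D} x \<subseteq> (\<Union>(a, b)\<in>{..<3*R} \<times> {..<3*R}. big 1 (B a \<union> B b) x)"
  proof
    fix \<omega> assume "\<omega> \<in> big 1 {1..D} x"
    then obtain i j where ij: "\<omega> \<in> space M" "i \<in> {1..D}" "j \<in> {1..D}" "i \<noteq> j"
      "x \<le> \<bar>X 1 i \<omega> * X 1 j \<omega>\<bar>"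
      unfolding big_def by blast
    have "\<exists>a<3*R. i \<in> B a" if i: "i \<in> {1..D}" for i
    proof (intro exI conjI)
      have "R * m \<le> 3 * R * l"
        using mult_le_mono2[OF l(3), of R] by (simp add: ac_simps)
      from order_trans[OF D this] have "i - 1 < 3 * R * l"
        using i unfolding atLeastAtMost_iff by linarith
      then show "(i - 1) div l < 3 * R"
        using l by (simp add: less_mult_imp_div_less)
      have "(i - 1) div l * l + (i - 1) mod l = i - 1" "(i - 1) mod l < l"
        using l by auto
      then show "i \<in> B ((i - 1) div l)"
        using i unfolding B_def atLeastAtMost_iff by linarith
    qed
    then obtain a b where ab: "a < 3*R" "b < 3*R" "i \<in> B a" "j \<in> B b"
      using ij by metis
    then have "\<omega> \<in> big 1 (B a \<union> B b) x"
      unfolding big_def using ij by blast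
    then show "\<omega> \<in> (\<Union>(a, b)\<in>{..<3*R} \<times> {..<3*R}. big 1 (B a \<union> B b) x)"
      using ab by blast
  qed
  have B1: "B a \<union> B b \<subseteq> {1..}" for a b
    by (auto simp: B_def)
  have "q D x \<le> prob (\<Union>(a, b)\<in>{..<3*R} \<times> {..<3*R}. big 1 (B a \<union> B b) x)"
    by (rule finite_measure_mono[OF sub]) (auto intro!: sets.finite_UN big_sets[OF _ B1])
  also have "\<dots> \<le> (\<Sum>(a, b)\<in>{..<3*R} \<times> {..<3*R}. prob (big 1 (B a \<union> B b) x))"
    unfolding case_prod_unfold
    by (rule finite_measure_subadditive_finite) (auto intro!: big_sets[OF _ B1])
  also have "\<dots> \<le> (\<Sum>(a, b)\<in>{..<3*R} \<times> {..<3*R}. q m x)"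
  proof (rule sum_mono, clarify)
    fix a b
    have "card (B a \<union> B b) \<le> card (B a) + card (B b)"
      by (rule card_Un_le)
    then have "card (B a \<union> B b) \<le> m"
      using l by (simp add: B_def)
    then show "prob (big 1 (B a \<union> B b) x) \<le> q m x"
      by (intro prob_big_le B1) (auto simp: B_def)
  qed
  also have "\<dots> = 9 * (real R)\<^sup>2 * q m x"
    by (simp add: case_prod_unfold card_cartesian_product power2_eq_square)
  finally show ?thesis .
qed

text \<open>Only the \<open>n div 2\<close> independent products of columns \<open>2 * a + 1\<close> and \<open>2 * a + 2\<close> are used.\<close>

lemma prob_product_le_q:
  fixes x :: real and n :: nat
  defines "h \<equiv> prob {\<omega> \<in> space M. x \<le> \<bar>X 1 1 \<omega> * X 1 2 \<omega>\<bar>}"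
  assumes n: "2 \<le> n" and half: "q n x \<le> 1 / 2"
  shows "real n * h \<le> 6 * q n x"
proof -
  define m where "m = n div 2"
  have m: "1 \<le> m" "2 * m \<le> n" "n \<le> 3 * m"
    using n unfolding m_def by presburger+
  define Z where "Z a \<omega> = case_prod X (1, 2 * a + 1) \<omega> * case_prod X (1, 2 * a + 2) \<omega>" for a \<omega>
  have ind: "indep_vars (\<lambda>_. borel) Z {..<m}"
    unfolding Z_def[abs_def]
  proof (rule indep_products)
    show "disjoint_family_on (\<lambda>a::nat. {(1::nat, 2 * a + 1), (1, 2 * a + 2)}) {..<m}"
      unfolding disjoint_family_on_def by simp
  qed simp_all
  have rvZ: "random_variable borel (Z a)" for a
    unfolding Z_def[abs_def] by (intro borel_measurable_times rv_case) simp_all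
  have sets_abs [simp]: "{z. x \<le> \<bar>z\<bar>} \<in> sets borel" "{z. \<bar>z\<bar> < x} \<in> sets borel"
    by measurable
  have h1: "h = measure (distr M borel (\<lambda>\<omega>. X 1 1 \<omega> * X 1 2 \<omega>)) {z. x \<le> \<bar>z\<bar>}"
    unfolding h_def using rv[of 1 1] rv[of 1 2]
    by (subst measure_distr) (simp_all add: vimage_def Collect_conj_eq Int_commute)
  have Zh: "prob (Z a -` {z. \<bar>z\<bar> < x} \<inter> space M) = 1 - h" for a
  proof -
    have "distr M borel (Z a) = distr M borel (\<lambda>\<omega>. X 1 1 \<omega> * X 1 2 \<omega>)"
      unfolding Z_def by (rule distr_product) auto
    then have "h = measure (distr M borel (Z a)) {z. x \<le> \<bar>z\<bar>}"
      by (simp add: h1)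
    also have "\<dots> = prob (Z a -` {z. x \<le> \<bar>z\<bar>} \<inter> space M)"
      by (rule measure_distr[OF rvZ sets_abs(1)])
    finally have h: "h = prob (Z a -` {z. x \<le> \<bar>z\<bar>} \<inter> space M)" .
    have "Z a -` {z. \<bar>z\<bar> < x} \<inter> space M = space M - (Z a -` {z. x \<le> \<bar>z\<bar>} \<inter> space M)"
      by auto
    moreover have "Z a -` {z. x \<le> \<bar>z\<bar>} \<inter> space M \<in> events"
      by (rule measurable_sets[OF rvZ sets_abs(1)])
    ultimately show ?thesis
      by (simp only: prob_compl h)
  qed
  have "1 - q n x = prob (space M - big 1 {1..n} x)"
    by (rule prob_compl[symmetric, OF big_sets]) auto
  also have "\<dots> \<le> prob (\<Inter>a\<in>{..<m}. Z a -` {z. \<bar>z\<bar> < x} \<inter> space M)"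
  proof (rule finite_measure_mono)
    show "(\<Inter>a\<in>{..<m}. Z a -` {z. \<bar>z\<bar> < x} \<inter> space M) \<in> events"
    proof (rule sets.finite_INT)
      show "Z a -` {z. \<bar>z\<bar> < x} \<inter> space M \<in> events" for a
        by (rule measurable_sets[OF rvZ sets_abs(2)])
    qed (use m in \<open>auto simp: lessThan_empty_iff\<close>)
    show "space M - big 1 {1..n} x \<subseteq> (\<Inter>a\<in>{..<m}. Z a -` {z. \<bar>z\<bar> < x} \<inter> space M)"
    proof
      fix \<omega> assume \<omega>: "\<omega> \<in> space M - big 1 {1..n} x"
      have "\<bar>Z a \<omega>\<bar> < x" if "a < m" for a
      proof (rule ccontr)
        assume "\<not> \<bar>Z a \<omega>\<bar> < x"
        then have "x \<le> \<bar>X 1 (2 * a + 1) \<omega> * X 1 (2 * a + 2) \<omega>\<bar>"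
          by (simp add: Z_def)
        moreover have "2 * a + 1 \<in> {1..n}" "2 * a + 2 \<in> {1..n}" "2 * a + 1 \<noteq> 2 * a + 2"
          using that m by auto
        ultimately have "\<omega> \<in> big 1 {1..n} x"
          using \<omega> unfolding big_def by blast
        then show False using \<omega> by blast
      qed
      then show "\<omega> \<in> (\<Inter>a\<in>{..<m}. Z a -` {z. \<bar>z\<bar> < x} \<inter> space M)"
        using \<omega> by blast
    qed
  qed
  also have "\<dots> = (\<Prod>a\<in>{..<m}. prob (Z a -` {z. \<bar>z\<bar> < x} \<inter> space M))"
    by (rule indep_varsD[OF ind]) (use m in \<open>auto simp: lessThan_empty_iff\<close>)
  also have "\<dots> = (1 - h) ^ m"
    by (simp only: Zh prod_constant card_lessThan)
  also have "\<dots> \<le> 1 / (1 + real m * h)"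
    by (rule one_minus_power_le) (auto simp: h_def)
  finally have "1 - q n x \<le> 1 / (1 + real m * h)" .
  moreover have "0 < 1 + real m * h"
    by (intro add_pos_nonneg mult_nonneg_nonneg) (auto simp: h_def)
  \<comment> \<open>Expanding gives m h \<le> q + q m h. The assumption q \<le> 1/2 lets the last
    term be absorbed on the left, so m h \<le> 2 q, and n \<le> 3 m turns 2 into 6.\<close>
  ultimately have "(1 - q n x) * (1 + real m * h) \<le> 1"
    by (simp only: pos_le_divide_eq)
  moreover have "q n x * (real m * h) \<le> 1 / 2 * (real m * h)"
    by (rule mult_right_mono[OF half]) (auto simp: h_def)
  ultimately have "real m * h \<le> 2 * q n x"
    by (simp add: algebra_simps)
  moreover have "real n * h \<le> (3 * real m) * h"
    using m(3) by (intro mult_right_mono) (auto simp: h_def)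
  ultimately show ?thesis by simp
qed

text \<open>Taking the power \<open>1 / \<alpha>\<close> turns the thresholds
  \<open>n powr \<alpha>\<close> into integers. The probability that \<open>Z\<close> reaches
  \<open>n\<close> is then eventually at most \<open>6 / n\<close> times the series term, which is
  the tail condition for a finite second moment of \<open>Z\<close>.\<close>

lemma integrable_product_powr:
  assumes \<alpha>: "0 < \<alpha>" and sum: "summable (\<lambda>n. q n (real n powr \<alpha>))"
  shows "integrable M (\<lambda>\<omega>. \<bar>X 1 1 \<omega> * X 1 2 \<omega>\<bar> powr (2 / \<alpha>))"
proof -
  have [measurable]: "random_variable borel (X 1 1)" "random_variable borel (X 1 2)"
    by (auto intro!: rv)
  define Z where "Z \<omega> = \<bar>X 1 1 \<omega> * X 1 2 \<omega>\<bar> powr (1 / \<alpha>)" for \<omega>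
  have [measurable]: "random_variable borel Z"
    unfolding Z_def by measurable
  have Zeq: "{\<omega> \<in> space M. real n \<le> Z \<omega>} = {\<omega> \<in> space M. real n powr \<alpha> \<le> \<bar>X 1 1 \<omega> * X 1 2 \<omega>\<bar>}" for n
  proof -
    have "real n \<le> z powr (1 / \<alpha>) \<longleftrightarrow> real n powr \<alpha> \<le> z" if "0 \<le> z" for z
    proof
      assume "real n \<le> z powr (1 / \<alpha>)"
      then have "real n powr \<alpha> \<le> (z powr (1 / \<alpha>)) powr \<alpha>"
        using \<alpha> by (intro powr_mono2) auto
      then show "real n powr \<alpha> \<le> z"
        using \<alpha> that by (simp add: powr_powr)
    next
      assume "real n powr \<alpha> \<le> z"
      then have "(real n powr \<alpha>) powr (1 / \<alpha>) \<le> z powr (1 / \<alpha>)"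
        using \<alpha> by (intro powr_mono2) auto
      then show "real n \<le> z powr (1 / \<alpha>)"
        using \<alpha> by (simp add: powr_powr)
    qed
    then show ?thesis
      by (auto simp: Z_def)
  qed
  have "summable (\<lambda>n. real n * prob {\<omega> \<in> space M. real n \<le> Z \<omega>})"
  proof (rule summable_comparison_test_ev)
    show "summable (\<lambda>n. 6 * q n (real n powr \<alpha>))"
      by (rule summable_mult[OF sum])
    have "\<forall>\<^sub>F n in sequentially. q n (real n powr \<alpha>) < 1 / 2"
      using summable_LIMSEQ_zero[OF sum] by (rule order_tendstoD) simp
    then show "\<forall>\<^sub>F n in sequentially. norm (real n * prob {\<omega> \<in> space M. real n \<le> Z \<omega>})
        \<le> 6 * q n (real n powr \<alpha>)"
      using eventually_ge_at_top[of 2]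
    proof eventually_elim
      case (elim n)
      then show ?case
        using prob_product_le_q[of n "real n powr \<alpha>"] by (simp add: Zeq abs_mult)
    qed
  qed
  moreover have "0 \<le> Z \<omega>" for \<omega>
    by (simp add: Z_def)
  ultimately have "(\<integral>\<^sup>+\<omega>. ennreal ((Z \<omega>)\<^sup>2) \<partial>M) < \<infinity>"
    by (intro nn_integral_square_finite) auto
  then have "integrable M (\<lambda>\<omega>. (Z \<omega>)\<^sup>2)"
    by (intro integrableI_nonneg) auto
  moreover have "(Z \<omega>)\<^sup>2 = \<bar>X 1 1 \<omega> * X 1 2 \<omega>\<bar> powr (2 / \<alpha>)" for \<omega>
    by (simp add: Z_def power2_eq_square powr_add[symmetric])
  ultimately show ?thesis by simp
qed

end

subsection \<open>Dyadic blocks and truncated moments\<close>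

text \<open>Block \<open>j\<close> has exactly \<open>2 ^ j\<close> elements, so a series with
  weights \<open>2 ^ j\<close> can be compared with an unweighted one block by block.\<close>

lemma sum_dyadic_blocks:
  fixes f :: "nat \<Rightarrow> real"
  shows "(\<Sum>j<J. \<Sum>m\<in>{2^j<..2^(j+1)}. f m) = (\<Sum>m\<in>{1<..2^J}. f m)"
proof (induction J)
  case (Suc J)
  have "{1<..2^(J+1)} = {1<..2^J} \<union> {2^J<..(2::nat)^(J+1)}"
    by (rule ivl_disj_un_two(6)[symmetric]) auto
  then have "(\<Sum>m\<in>{1<..2^(J+1)}. f m) = (\<Sum>m\<in>{1<..2^J}. f m) + (\<Sum>m\<in>{2^J<..2^(J+1)}. f m)"
    by (simp only:) (rule sum.union_disjoint, auto)
  then show ?case using Suc by simp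
qed simp

text \<open>The choice of \<open>t\<close> makes \<open>t n * y n\<close> equal to \<gamma> ln n, so
  that the exponential factor is \<open>n powr \<gamma>\<close>. Up to constants the two terms are
  then ln n times \<open>n powr (1 - \<alpha> * r1)\<close>, and the square of ln n times
  \<open>n powr (1 + \<gamma> - \<alpha> * r2)\<close>. The assumptions on \<open>r1\<close> and
  \<open>r2\<close> say that these exponents are negative.\<close>

lemma moment_rate:
  fixes \<alpha> e \<gamma> r1 r2 C1 C2 :: real
  defines "y \<equiv> \<lambda>n::nat. e * real n powr \<alpha>"
  defines "t \<equiv> \<lambda>n::nat. \<gamma> * ln (real n) / y n"
  assumes e: "0 < e" and r1: "1 < \<alpha> * r1" and r2: "1 + \<gamma> < \<alpha> * r2"
  shows "(\<lambda>n. real n * (t n * (C1 * y n powr (1 - r1))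
      + (t n)\<^sup>2 * exp (t n * y n) * (C2 * y n powr (2 - r2)))) \<longlonglongrightarrow> 0"
proof -
  define a b where "a = 1 - \<alpha> * r1" and "b = 1 + \<gamma> - \<alpha> * r2"
  have ab: "a < 0" "b < 0"
    using r1 r2 by (auto simp: a_def b_def)
  let ?g = "\<lambda>n::nat. \<gamma> * C1 * e powr (- r1) * (ln (real n) * real n powr a)
      + \<gamma>\<^sup>2 * C2 * e powr (- r2) * ((ln (real n))\<^sup>2 * real n powr b)"
  have "(\<lambda>n::nat. ln (real n) * real n powr a) \<longlonglongrightarrow> 0"
       "(\<lambda>n::nat. (ln (real n))\<^sup>2 * real n powr b) \<longlonglongrightarrow> 0"
    using ab by real_asymp+
  then have "?g \<longlonglongrightarrow> \<gamma> * C1 * e powr (- r1) * 0 + \<gamma>\<^sup>2 * C2 * e powr (- r2) * 0"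
    by (intro tendsto_intros)
  then have lim: "?g \<longlonglongrightarrow> 0" by simp
  show ?thesis
  proof (rule Lim_transform_eventually[OF lim])
    show "\<forall>\<^sub>F n in sequentially. ?g n = real n * (t n * (C1 * y n powr (1 - r1))
        + (t n)\<^sup>2 * exp (t n * y n) * (C2 * y n powr (2 - r2)))"
      using eventually_gt_at_top[of 0]
    proof eventually_elim
      case (elim n)
      then have n: "0 < real n" by simp
      have y: "0 < y n"
        using n e by (simp add: y_def)
      have ty: "t n * y n = \<gamma> * ln (real n)"
        using y by (simp add: t_def)
      have ex: "exp (t n * y n) = real n powr \<gamma>"
        using n by (simp add: ty powr_def)
      have yp: "y n powr (- r) = e powr (- r) * real n powr (- (\<alpha> * r))" for r
        using n e by (simp add: y_def powr_mult powr_powr)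
      have m1: "t n * (C1 * y n powr (1 - r1)) = (t n * y n) * C1 * y n powr (- r1)"
        using y by (simp add: powr_diff powr_minus field_simps)
      have m2: "(t n)\<^sup>2 * exp (t n * y n) * (C2 * y n powr (2 - r2))
          = (t n * y n)\<^sup>2 * exp (t n * y n) * C2 * y n powr (- r2)"
        using y by (simp add: powr_diff powr_minus powr_numeral field_simps power2_eq_square)
      have m3: "real n powr a = real n * real n powr (- (\<alpha> * r1))"
        using n by (simp add: a_def powr_diff powr_minus field_simps)
      have m4: "real n powr b = real n * real n powr \<gamma> * real n powr (- (\<alpha> * r2))"
        using n by (simp add: b_def powr_diff powr_add powr_minus field_simps)
      show ?case
        unfolding m1 m2 m3 m4 unfolding ex unfolding ty yp by (simp add: power2_eq_square algebra_simps)
    qed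
  qed
qed

section \<open>Elementary bounds for the maximum over column pairs\<close>

lemma finite_pair_values:
  fixes g :: "nat \<Rightarrow> nat \<Rightarrow> real" and N :: nat
  shows "finite (insert 0 {g i j | i j. 1 \<le> i \<and> i < j \<and> j \<le> N})"
proof -
  have "{g i j | i j. 1 \<le> i \<and> i < j \<and> j \<le> N} \<subseteq> (\<lambda>(i, j). g i j) ` ({..N} \<times> {..N})"
  proof clarify
    fix i j assume "1 \<le> i" "i < j" "j \<le> N"
    then have "i \<le> N" "j \<le> N" by linarith+
    then show "g i j \<in> (\<lambda>(i, j). g i j) ` ({..N} \<times> {..N})"
      by (intro image_eqI[of _ _ "(i, j)"]) auto
  qed
  then show ?thesis
    using finite_subset by blast
qed

lemma W_stat_less:
  assumes "0 < c"
    and "\<And>i j. 1 \<le> i \<Longrightarrow> i < j \<Longrightarrow> j \<le> p n \<Longrightarrow> \<bar>\<Sum>k=1..n. X k i \<omega> * X k j \<omega>\<bar> < c"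
  shows "W_stat X p n \<omega> < c"
  unfolding W_stat_def by (subst Max_less_iff[OF finite_pair_values]) (use assms in auto)

lemma W_stat_ge:
  assumes "1 \<le> i" "i < j" "j \<le> p n"
  shows "\<bar>\<Sum>k=1..n. X k i \<omega> * X k j \<omega>\<bar> \<le> W_stat X p n \<omega>"
  unfolding W_stat_def by (rule Max_ge[OF finite_pair_values]) (use assms in blast)

lemma W_stat_nonneg: "0 \<le> W_stat X p n \<omega>"
  unfolding W_stat_def by (rule Max_ge[OF finite_pair_values]) blast

context iid_array
begin

text \<open>The summand is a union bound for all rows up to \<open>2 ^ (k + 1)\<close>. It is
  compared with every \<open>q m (m powr \<alpha>)\<close> for \<open>m\<close> in a dyadic block
  lying \<open>s + 1\<close> steps earlier. That block has \<open>2 ^ j\<close> members, so the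
  weight is paid by the plain sum over the block.\<close>

lemma dyadic_summable:
  assumes \<alpha>: "0 < \<alpha>" and \<epsilon>: "0 < \<epsilon>" and sum: "summable (\<lambda>n. q n (real n powr \<alpha>))"
  shows "summable (\<lambda>k. 2 ^ (k + 1) * q (R * 2 ^ (k + 1)) (\<epsilon> * (2 ^ k) powr \<alpha>))"
proof -
  \<comment> \<open>The shift \<open>s\<close> absorbs \<open>\<epsilon>\<close>: for \<open>m \<le> 2 ^ (k - s)\<close> the threshold \<open>m powr \<alpha>\<close> lies below \<open>\<epsilon> * (2 ^ k) powr \<alpha>\<close>.\<close>
  obtain s where "(1 / 2 :: real) ^ s < \<epsilon> powr (1 / \<alpha>)"
    using real_arch_pow_inv[of "\<epsilon> powr (1 / \<alpha>)" "1 / 2"] \<epsilon> by auto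
  then have "((1 / 2 :: real) ^ s) powr \<alpha> \<le> (\<epsilon> powr (1 / \<alpha>)) powr \<alpha>"
    using \<alpha> by (intro powr_mono2) auto
  then have s: "((1 / 2 :: real) ^ s) powr \<alpha> \<le> \<epsilon>"
    using \<alpha> \<epsilon> by (simp add: powr_powr)
  \<comment> \<open>Chosen so that \<open>R * 2 ^ (k + 1) = R' * 2 ^ j\<close> when
    \<open>k = j + s + 1\<close>: the columns lost by moving to an earlier block are made up by a
    larger constant.\<close>
  define R' where "R' = R * 2 ^ (s + 2)"
  define f where "f m = q m (real m powr \<alpha>)" for m
  define g where "g k = q (R * 2 ^ (k + 1)) (\<epsilon> * (2 ^ k) powr \<alpha>)" for k
  define K where "K = 9 * (real R')\<^sup>2"
  have f0: "0 \<le> f m" for m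
    by (simp add: f_def)
  have K0: "0 \<le> K"
    by (simp add: K_def)
  have sf: "summable f"
    using sum by (simp add: f_def[abs_def])
  have le: "g (j + s + 1) \<le> K * f m" if m: "m \<in> {2^j<..2^(j+1)}" for j m
  proof -
    define k where "k = j + s + 1"
    have "real m \<le> 2 ^ (j + 1)"
      using m by (metis greaterThanAtMost_iff of_nat_le_iff of_nat_numeral of_nat_power)
    also have "\<dots> = 2 ^ k * (1 / 2) ^ s"
      by (simp add: k_def power_add power_divide)
    finally have "real m powr \<alpha> \<le> (2 ^ k * (1 / 2) ^ s) powr \<alpha>"
      using \<alpha> by (intro powr_mono2) auto
    also have "\<dots> = (2 ^ k) powr \<alpha> * ((1 / 2) ^ s) powr \<alpha>"
      by (rule powr_mult)
    also have "\<dots> \<le> (2 ^ k) powr \<alpha> * \<epsilon>"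
      by (rule mult_left_mono[OF s]) simp
    finally have x: "real m powr \<alpha> \<le> \<epsilon> * (2 ^ k) powr \<alpha>"
      by (simp add: mult.commute)
    have "g k \<le> q (R * 2 ^ (k + 1)) (real m powr \<alpha>)"
      unfolding g_def by (rule finite_measure_mono[OF big_mono[OF order_refl x] big_sets]) auto
    also have "\<dots> \<le> 9 * (real R')\<^sup>2 * q m (real m powr \<alpha>)"
    proof (rule q_scale_le)
      have "(1::nat) \<le> 2 ^ j" by simp
      then show "2 \<le> m"
        using m unfolding greaterThanAtMost_iff by linarith
      have "R * 2 ^ (k + 1) = R' * 2 ^ j"
        by (simp add: R'_def k_def power_add)
      also have "\<dots> \<le> R' * m"
        using m by (intro mult_left_mono) auto
      finally show "R * 2 ^ (k + 1) \<le> R' * m" .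
    qed
    finally show ?thesis
      by (simp add: k_def K_def f_def)
  qed
  have "summable (\<lambda>j. 2 ^ j * g (j + s + 1))"
  proof (rule summableI_nonneg_bounded)
    fix J
    have "(\<Sum>j<J. 2 ^ j * g (j + s + 1)) = (\<Sum>j<J. \<Sum>m\<in>{(2::nat)^j<..2^(j+1)}. g (j + s + 1))"
      by (rule sum.cong) (simp_all add: of_nat_power)
    also have "\<dots> \<le> (\<Sum>j<J. \<Sum>m\<in>{(2::nat)^j<..2^(j+1)}. K * f m)"
      by (intro sum_mono le)
    also have "\<dots> = K * (\<Sum>m\<in>{1<..2^J}. f m)"
      by (simp only: sum_distrib_left[symmetric] sum_dyadic_blocks)
    also have "\<dots> \<le> K * (\<Sum>m. f m)"
      by (intro mult_left_mono sum_le_suminf sf f0 K0) auto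
    finally show "(\<Sum>j<J. 2 ^ j * g (j + s + 1)) \<le> K * (\<Sum>m. f m)" .
  qed (simp add: g_def)
  \<comment> \<open>The constant converts the weight \<open>2 ^ j\<close> of the comparison block
    into the weight \<open>2 ^ (k + 1)\<close> with \<open>k = j + s + 1\<close>.\<close>
  then have "summable (\<lambda>j. 2 ^ (s + 2) * (2 ^ j * g (j + s + 1)))"
    by (rule summable_mult)
  then have "summable (\<lambda>j. 2 ^ (j + (s + 1) + 1) * g (j + (s + 1)))"
    by (simp add: power_add mult_ac)
  then have "summable (\<lambda>k. 2 ^ (k + 1) * g k)"
    by (rule summable_iff_shift[of "\<lambda>k. 2 ^ (k + 1) * g k" "s + 1", THEN iffD1])
  then show ?thesis
    by (simp only: g_def)
qed

abbreviation Y12 :: "'a \<Rightarrow> real" where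
  "Y12 \<omega> \<equiv> X 1 1 \<omega> * X 1 2 \<omega>"

lemma rv_Y12: "random_variable borel Y12"
proof -
  have [measurable]: "random_variable borel (X 1 1)" "random_variable borel (X 1 2)"
    by (auto intro!: rv)
  show ?thesis by measurable
qed

lemma second_entry:
  assumes int: "integrable M (X 1 1)"
  shows "integrable M (X 1 2)" "expectation (X 1 2) = expectation (X 1 1)"
proof -
  have rv12: "random_variable borel (X 1 1)" "random_variable borel (X 1 2)"
    by (rule rv; simp)+
  have distr12: "distr M borel (X 1 2) = distr M borel (X 1 1)"
    by (rule ident) simp_all
  have "integrable (distr M borel (X 1 1)) (\<lambda>x. x)"
    by (subst integrable_distr_eq[OF rv12(1)]) (simp_all only: int measurable_ident_sets)
  then show "integrable M (X 1 2)"
    unfolding distr12[symmetric] by (subst (asm) integrable_distr_eq[OF rv12(2)]) simp_all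
  show "expectation (X 1 2) = expectation (X 1 1)"
    using integral_distr[OF rv12(1), of "\<lambda>x. x"] integral_distr[OF rv12(2), of "\<lambda>x. x"]
    by (simp only: distr12 measurable_ident_sets)
qed

lemma expectation_Y12:
  assumes int: "integrable M (X 1 1)"
  shows "integrable M Y12" "expectation Y12 = expectation (X 1 1) * expectation (X 1 1)"
proof -
  have ind: "indep_var borel (X 1 1) borel (X 1 2)"
    using indep_pair[of "(1, 1)" "(1, 2)"] by simp
  show "integrable M Y12"
    by (rule indep_var_integrable[OF ind int second_entry(1)[OF int]])
  show "expectation Y12 = expectation (X 1 1) * expectation (X 1 1)"
    using indep_var_lebesgue_integral[OF ind int second_entry(1)[OF int]]
    by (simp only: second_entry(2)[OF int])
qed

lemma integrable_Y12_powr: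
  assumes \<alpha>: "0 < \<alpha>" and sum: "summable (\<lambda>n. q n (real n powr \<alpha>))" and r: "0 < r" "r \<le> 2 / \<alpha>"
  shows "integrable M (\<lambda>\<omega>. \<bar>Y12 \<omega>\<bar> powr r)"
proof (rule Bochner_Integration.integrable_bound)
  show "integrable M (\<lambda>\<omega>. 1 + \<bar>Y12 \<omega>\<bar> powr (2 / \<alpha>))"
    by (rule Bochner_Integration.integrable_add[OF _ integrable_product_powr[OF \<alpha> sum]]) simp
  show "random_variable borel (\<lambda>\<omega>. \<bar>Y12 \<omega>\<bar> powr r)"
    using rv_Y12 by measurable
  have "z powr r \<le> 1 + z powr (2 / \<alpha>)" if "0 \<le> z" for z :: real
  proof (cases "z \<le> 1")
    case True
    then have "z powr r \<le> 1"
      using that r by (intro powr_le1) auto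
    then show ?thesis using powr_ge_zero[of z "2 / \<alpha>"] by linarith
  next
    case False
    then have "z powr r \<le> z powr (2 / \<alpha>)"
      using r by (intro powr_mono) auto
    then show ?thesis by simp
  qed
  then show "AE \<omega> in M. norm (\<bar>Y12 \<omega>\<bar> powr r) \<le> norm (1 + \<bar>Y12 \<omega>\<bar> powr (2 / \<alpha>))"
    by (intro AE_I2) (simp add: add_nonneg_nonneg abs_of_nonneg del: abs_mult)
qed

lemma trunc_second_moment:
  assumes \<alpha>: "0 < \<alpha>" and sum: "summable (\<lambda>n. q n (real n powr \<alpha>))" and r: "0 < r" "r \<le> 2" "r \<le> 2 / \<alpha>"
    and y: "0 < y"
  shows "expectation (\<lambda>\<omega>. (trunc y (Y12 \<omega>))\<^sup>2)
    \<le> expectation (\<lambda>\<omega>. \<bar>Y12 \<omega>\<bar> powr r) * y powr (2 - r)"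
proof -
  note [measurable] = rv_Y12
  have i: "integrable M (\<lambda>\<omega>. \<bar>Y12 \<omega>\<bar> powr r)"
    by (rule integrable_Y12_powr[OF \<alpha> sum]) (use r in auto)
  have "expectation (\<lambda>\<omega>. (trunc y (Y12 \<omega>))\<^sup>2) \<le> expectation (\<lambda>\<omega>. y powr (2 - r) * \<bar>Y12 \<omega>\<bar> powr r)"
  proof (rule integral_mono)
    show "integrable M (\<lambda>\<omega>. (trunc y (Y12 \<omega>))\<^sup>2)"
    proof (rule integrable_const_bound[where B="y\<^sup>2"])
      show "AE \<omega> in M. norm ((trunc y (Y12 \<omega>))\<^sup>2) \<le> y\<^sup>2"
        using power_mono[OF abs_trunc_le[of y] abs_ge_zero, of _ 2] y by simp
    qed measurable
  qed (use i trunc_square_le_powr[OF r(1,2) y] in auto)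
  then show ?thesis by (simp add: mult.commute)
qed

lemma integrable_trunc:
  assumes "0 < y"
  shows "integrable M (\<lambda>\<omega>. trunc y (Y12 \<omega>))"
proof (rule integrable_const_bound[where B=y])
  show "random_variable borel (\<lambda>\<omega>. trunc y (Y12 \<omega>))"
    using rv_Y12 by measurable
qed (use abs_trunc_le[of y] assms in auto)

text \<open>Two mechanisms give a bound of one form. For \<alpha> \<le> 1 the product is centred, so
  the truncated mean is minus the mean of the discarded part, and the order \<open>r\<close> is at
  least 1. For \<alpha> > 1 the mean of the absolute truncated product is bounded directly, with
  \<open>r\<close> at most 1.\<close>

lemma trunc_mean:
  assumes \<alpha>: "0 < \<alpha>" and sum: "summable (\<lambda>n. q n (real n powr \<alpha>))"
    and mean: "\<alpha> \<le> 1 \<Longrightarrow> integrable M (X 1 1) \<and> expectation (X 1 1) = 0"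
    and y: "0 < y"
  defines "r \<equiv> (if \<alpha> \<le> 1 then 2 / \<alpha> else min 1 (2 / \<alpha>))"
  shows "\<bar>expectation (\<lambda>\<omega>. trunc y (Y12 \<omega>))\<bar>
    \<le> expectation (\<lambda>\<omega>. \<bar>Y12 \<omega>\<bar> powr r) * y powr (1 - r)"
proof -
  note [measurable] = rv_Y12
  have r: "0 < r" "r \<le> 2 / \<alpha>"
    using \<alpha> by (auto simp: r_def)
  have i: "integrable M (\<lambda>\<omega>. \<bar>Y12 \<omega>\<bar> powr r)"
    by (rule integrable_Y12_powr[OF \<alpha> sum r])
  show ?thesis
  proof (cases "\<alpha> \<le> 1")
    case True
    have int: "integrable M (X 1 1)" and zero: "expectation (X 1 1) = 0"
      using mean True by auto
    have intY: "integrable M Y12" and zY: "expectation Y12 = 0"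
      using expectation_Y12[OF int] by (simp_all only: zero mult_zero_left)
    have r1: "1 \<le> r"
      using True \<alpha> by (simp add: r_def field_simps)
    have "\<bar>expectation (\<lambda>\<omega>. trunc y (Y12 \<omega>))\<bar> = \<bar>expectation (\<lambda>\<omega>. Y12 \<omega> - trunc y (Y12 \<omega>))\<bar>"
      using zY intY integrable_trunc[OF y] by simp
    also have "\<dots> \<le> expectation (\<lambda>\<omega>. \<bar>Y12 \<omega> - trunc y (Y12 \<omega>)\<bar>)"
      by (rule integral_abs_bound)
    also have "\<dots> \<le> expectation (\<lambda>\<omega>. y powr (1 - r) * \<bar>Y12 \<omega>\<bar> powr r)"
    proof (rule integral_mono)
      show "integrable M (\<lambda>\<omega>. \<bar>Y12 \<omega> - trunc y (Y12 \<omega>)\<bar>)"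
        by (rule integrable_abs[OF Bochner_Integration.integrable_diff[OF intY integrable_trunc[OF y]]])
      show "\<bar>Y12 \<omega> - trunc y (Y12 \<omega>)\<bar> \<le> y powr (1 - r) * \<bar>Y12 \<omega>\<bar> powr r" for \<omega>
        by (rule abs_diff_trunc_le_powr[OF r1 y])
    qed (rule integrable_mult_right[OF i])
    finally show ?thesis by (simp add: mult.commute)
  next
    case False
    then have r1: "r \<le> 1"
      by (simp add: r_def)
    have "\<bar>expectation (\<lambda>\<omega>. trunc y (Y12 \<omega>))\<bar> \<le> expectation (\<lambda>\<omega>. \<bar>trunc y (Y12 \<omega>)\<bar>)"
      by (rule integral_abs_bound)
    also have "\<dots> \<le> expectation (\<lambda>\<omega>. y powr (1 - r) * \<bar>Y12 \<omega>\<bar> powr r)"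
    proof (rule integral_mono)
      show "integrable M (\<lambda>\<omega>. \<bar>trunc y (Y12 \<omega>)\<bar>)"
        by (rule integrable_abs[OF integrable_trunc[OF y]])
      show "\<bar>trunc y (Y12 \<omega>)\<bar> \<le> y powr (1 - r) * \<bar>Y12 \<omega>\<bar> powr r" for \<omega>
        by (rule abs_trunc_le_powr[OF r(1) r1 y])
    qed (rule integrable_mult_right[OF i])
    finally show ?thesis by (simp add: mult.commute)
  qed
qed

subsection \<open>Sufficiency\<close>

lemma expectation_entry_product:
  fixes f :: "real \<Rightarrow> real"
  assumes [measurable]: "f \<in> borel_measurable borel" and kij: "1 \<le> k" "1 \<le> i" "1 \<le> j" "i \<noteq> j"
  shows "expectation (\<lambda>\<omega>. f (X k i \<omega> * X k j \<omega>)) = expectation (\<lambda>\<omega>. f (Y12 \<omega>))"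
    and "integrable M (\<lambda>\<omega>. f (X k i \<omega> * X k j \<omega>)) \<longleftrightarrow> integrable M (\<lambda>\<omega>. f (Y12 \<omega>))"
proof -
  have [measurable]: "random_variable borel (X k i)" "random_variable borel (X k j)"
    using rv kij by auto
  have Z: "random_variable borel (\<lambda>\<omega>. X k i \<omega> * X k j \<omega>)"
    by measurable
  have d: "distr M borel (\<lambda>\<omega>. X k i \<omega> * X k j \<omega>) = distr M borel Y12"
    using distr_product[of "(k, i)" "(k, j)"] kij by simp
  show "expectation (\<lambda>\<omega>. f (X k i \<omega> * X k j \<omega>)) = expectation (\<lambda>\<omega>. f (Y12 \<omega>))"
    using integral_distr[OF Z assms(1)] integral_distr[OF rv_Y12 assms(1)] by (simp only: d)
  show "integrable M (\<lambda>\<omega>. f (X k i \<omega> * X k j \<omega>)) \<longleftrightarrow> integrable M (\<lambda>\<omega>. f (Y12 \<omega>))"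
    using integrable_distr_eq[OF Z assms(1)] integrable_distr_eq[OF rv_Y12 assms(1)] by (simp only: d)
qed

lemma indep_entry_products:
  assumes "1 \<le> i" "1 \<le> j" "i \<noteq> j"
  shows "indep_vars (\<lambda>_. borel) (\<lambda>k \<omega>. X k i \<omega> * X k j \<omega>) {1..n}"
proof -
  have "indep_vars (\<lambda>_. borel) (\<lambda>k \<omega>. case_prod X (k, i) \<omega> * case_prod X (k, j) \<omega>) {1..n}"
    by (rule indep_products) (use assms in \<open>auto simp: disjoint_family_on_def\<close>)
  then show ?thesis by simp
qed

text \<open>With truncation level \<open>y = e * n powr \<alpha>\<close> and exponent \<open>t = \<gamma> * ln n / y\<close> in the exponential
  bound, the moment terms vanish for small \<open>\<gamma>\<close>, while the factor \<open>exp (- t * \<epsilon> * n powr \<alpha>)\<close> is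
  \<open>n powr (- \<gamma> * \<epsilon> / e)\<close>; \<open>e\<close> is chosen to make this exponent \<open>- 5\<close>.\<close>

lemma truncated_sum_tail:
  assumes \<alpha>: "1 / 2 < \<alpha>" and sum: "summable (\<lambda>n. q n (real n powr \<alpha>))"
    and mean: "\<alpha> \<le> 1 \<Longrightarrow> integrable M (X 1 1) \<and> expectation (X 1 1) = 0"
    and \<epsilon>: "0 < \<epsilon>"
  obtains e where "0 < e" and
    "\<forall>\<^sub>F n in sequentially. \<forall>i j. 1 \<le> i \<longrightarrow> 1 \<le> j \<longrightarrow> i \<noteq> j \<longrightarrow>
      prob {\<omega> \<in> space M. \<epsilon> * real n powr \<alpha>
          \<le> \<bar>\<Sum>k=1..n. trunc (e * real n powr \<alpha>) (X k i \<omega> * X k j \<omega>)\<bar>}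
        \<le> 2 * exp 1 / real n ^ 5"
proof
  \<comment> \<open>Half of the gap between 1 and
    \<open>\<alpha> * r2 = min (2 * \<alpha>) 2\<close>, so that
    \<open>1 + \<gamma> < \<alpha> * r2\<close>. The gap is positive exactly because \<alpha> >
    1/2.\<close>
  define \<gamma> where "\<gamma> = min (2 * \<alpha> - 1) 1 / 2"
  define e where "e = \<epsilon> * \<gamma> / 5"
  have \<alpha>0: "0 < \<alpha>"
    using \<alpha> by simp
  have \<gamma>: "0 < \<gamma>"
    using \<alpha> by (simp add: \<gamma>_def)
  show e: "0 < e"
    using \<epsilon> \<gamma> by (simp add: e_def)
  \<comment> \<open>The order of \<open>trunc_mean\<close>. Here \<open>\<alpha> * r1\<close> is 2
    if \<alpha> \<le> 1 and \<open>min \<alpha> 2\<close> otherwise, in both cases above 1.\<close>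
  define r1 where "r1 = (if \<alpha> \<le> 1 then 2 / \<alpha> else min 1 (2 / \<alpha>))"
  define r2 where "r2 = min 2 (2 / \<alpha>)"
  have r1: "1 < \<alpha> * r1"
    using \<alpha>0 by (auto simp: r1_def min_def field_simps)
  have "\<alpha> * r2 = min (2 * \<alpha>) 2"
    using \<alpha>0 by (auto simp: r2_def min_def field_simps)
  then have r2: "1 + \<gamma> < \<alpha> * r2"
    using \<gamma> \<alpha> by (auto simp: \<gamma>_def min_def field_simps split: if_splits)
  have r2': "0 < r2" "r2 \<le> 2" "r2 \<le> 2 / \<alpha>"
    using \<alpha>0 by (auto simp: r2_def)
  define C1 where "C1 = expectation (\<lambda>\<omega>. \<bar>Y12 \<omega>\<bar> powr r1)"
  define C2 where "C2 = expectation (\<lambda>\<omega>. \<bar>Y12 \<omega>\<bar> powr r2)"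
  define y where "y n = e * real n powr \<alpha>" for n :: nat
  define t where "t n = \<gamma> * ln (real n) / y n" for n :: nat
  define m where "m n = C1 * y n powr (1 - r1)" for n
  define s where "s n = C2 * y n powr (2 - r2)" for n
  have "(\<lambda>n. real n * (t n * m n + (t n)\<^sup>2 * exp (t n * y n) * s n)) \<longlonglongrightarrow> 0"
    unfolding t_def m_def s_def y_def by (rule moment_rate[OF e r1 r2])
  then have "\<forall>\<^sub>F n in sequentially. real n * (t n * m n + (t n)\<^sup>2 * exp (t n * y n) * s n) < 1"
    by (rule order_tendstoD) simp
  then show "\<forall>\<^sub>F n in sequentially. \<forall>i j. 1 \<le> i \<longrightarrow> 1 \<le> j \<longrightarrow> i \<noteq> j \<longrightarrow>
      prob {\<omega> \<in> space M. \<epsilon> * real n powr \<alpha>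
          \<le> \<bar>\<Sum>k=1..n. trunc (e * real n powr \<alpha>) (X k i \<omega> * X k j \<omega>)\<bar>}
        \<le> 2 * exp 1 / real n ^ 5"
    using eventually_ge_at_top[of 2]
  proof eventually_elim
    case (elim n)
    have n: "1 < real n"
      using elim(2) by simp
    have y: "0 < y n"
      using e n by (simp add: y_def)
    have t: "0 < t n"
      using \<gamma> n y by (simp add: t_def)
    have "\<epsilon> * real n powr \<alpha> = 5 / \<gamma> * y n"
      using \<gamma> by (simp add: y_def e_def)
    then have tx: "t n * (\<epsilon> * real n powr \<alpha>) = 5 * ln (real n)"
      using y \<gamma> by (simp add: t_def)
    show ?case
    proof (intro allI impI)
      fix i j :: nat assume ij: "1 \<le> i" "1 \<le> j" "i \<noteq> j"
      have ind: "indep_vars (\<lambda>_. borel) (\<lambda>k \<omega>. trunc (y n) (X k i \<omega> * X k j \<omega>)) {1..n}"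
        by (rule indep_vars_compose2[OF indep_entry_products[OF ij]]) measurable
      have "prob {\<omega> \<in> space M. \<epsilon> * real n powr \<alpha> \<le> \<bar>\<Sum>k=1..n. trunc (y n) (X k i \<omega> * X k j \<omega>)\<bar>}
          \<le> 2 * exp (- t n * (\<epsilon> * real n powr \<alpha>)
              + real (card {1..n}) * (t n * m n + (t n)\<^sup>2 * exp (t n * y n) * s n))"
      proof (rule prob_abs_sum_ge_le[OF ind _ _ _ _ t])
        fix k assume k: "k \<in> {1..n}"
        then have k1: "1 \<le> k" by simp
        have "expectation (\<lambda>\<omega>. trunc (y n) (X k i \<omega> * X k j \<omega>)) = expectation (\<lambda>\<omega>. trunc (y n) (Y12 \<omega>))"
          by (rule expectation_entry_product(1)[OF measurable_trunc k1 ij])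
        then show "\<bar>expectation (\<lambda>\<omega>. trunc (y n) (X k i \<omega> * X k j \<omega>))\<bar> \<le> m n"
          using trunc_mean[OF \<alpha>0 sum mean y] by (simp only: m_def C1_def r1_def)
        have "expectation (\<lambda>\<omega>. (trunc (y n) (X k i \<omega> * X k j \<omega>))\<^sup>2) = expectation (\<lambda>\<omega>. (trunc (y n) (Y12 \<omega>))\<^sup>2)"
          by (rule expectation_entry_product(1)[OF borel_measurable_power[OF measurable_trunc] k1 ij])
        then show "expectation (\<lambda>\<omega>. (trunc (y n) (X k i \<omega> * X k j \<omega>))\<^sup>2) \<le> s n"
          using trunc_second_moment[OF \<alpha>0 sum r2' y] by (simp only: s_def C2_def)
      qed (use abs_trunc_le[of "y n"] y in auto)
      also have "\<dots> \<le> 2 * exp (- (5 * ln (real n)) + 1)"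
        using elim(1) by (simp only: mult_minus_left tx card_atLeastAtMost) simp
      also have "\<dots> = 2 * exp 1 / real n ^ 5"
      proof -
        have "exp (5 * ln (real n)) = real n ^ 5"
          using exp_of_nat_mult[of 5 "ln (real n)"] n by simp
        then show ?thesis
          by (simp only: exp_add exp_minus) (simp only: inverse_eq_divide times_divide_eq_left times_divide_eq_right mult_1)
      qed
      finally show "prob {\<omega> \<in> space M. \<epsilon> * real n powr \<alpha>
          \<le> \<bar>\<Sum>k=1..n. trunc (e * real n powr \<alpha>) (X k i \<omega> * X k j \<omega>)\<bar>} \<le> 2 * exp 1 / real n ^ 5"
        by (simp only: y_def)
    qed
  qed
qed

text \<open>At most \<open>(R * n)\<^sup>2\<close> pairs share a tail of order 5, which leaves the
  summable order 3 for Borel-Cantelli.\<close>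

lemma eventually_truncated_small:
  assumes R: "\<And>n. 1 \<le> n \<Longrightarrow> p n \<le> R * n"
    and tail: "\<forall>\<^sub>F n in sequentially. \<forall>i j. 1 \<le> i \<longrightarrow> 1 \<le> j \<longrightarrow> i \<noteq> j \<longrightarrow>
      prob {\<omega> \<in> space M. x n \<le> \<bar>\<Sum>k=1..n. trunc (y n) (X k i \<omega> * X k j \<omega>)\<bar>} \<le> C / real n ^ 5"
  shows "AE \<omega> in M. \<forall>\<^sub>F n in sequentially. \<forall>i j. 1 \<le> i \<longrightarrow> i < j \<longrightarrow> j \<le> p n \<longrightarrow>
      \<bar>\<Sum>k=1..n. trunc (y n) (X k i \<omega> * X k j \<omega>)\<bar> < x n"
proof -
  define E where "E n u = {\<omega> \<in> space M. x n \<le> \<bar>\<Sum>k=1..n. trunc (y n) (X k (fst u) \<omega> * X k (snd u) \<omega>)\<bar>}"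
    for n and u :: "nat \<times> nat"
  define T where "T n = {u. 1 \<le> fst u \<and> fst u < snd u \<and> snd u \<le> p n}" for n
  have Tsub: "T n \<subseteq> {1..p n} \<times> {1..p n}" for n
    by (auto simp: T_def)
  have Tfin: "finite (T n)" for n
    by (rule finite_subset[OF Tsub]) simp
  have Tcard: "card (T n) \<le> p n * p n" for n
    using card_mono[OF _ Tsub, of n] by simp
  have E: "E n u \<in> events" if "u \<in> T n" for n u
  proof -
    have u: "1 \<le> fst u" "1 \<le> snd u"
      using that by (auto simp: T_def)
    have [measurable]: "random_variable borel (X k (fst u))" "random_variable borel (X k (snd u))"
      if "k \<in> {1..n}" for k
      using that u rv by simp_all
    show ?thesis
      unfolding E_def by measurable
  qed
  define H where "H n = (\<Union>u\<in>T n. E n u)" for n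
  have H: "H n \<in> events" for n
    unfolding H_def by (intro sets.finite_UN Tfin E)
  have "summable (\<lambda>n. prob (H n))"
  proof (rule summable_comparison_test_ev)
    show "summable (\<lambda>n. \<bar>C\<bar> * (real R)\<^sup>2 * inverse (real n ^ 3))"
      by (intro summable_mult inverse_power_summable) simp
    show "\<forall>\<^sub>F n in sequentially. norm (prob (H n)) \<le> \<bar>C\<bar> * (real R)\<^sup>2 * inverse (real n ^ 3)"
      using tail eventually_ge_at_top[of 1]
    proof eventually_elim
      case (elim n)
      have "prob (H n) \<le> (\<Sum>u\<in>T n. prob (E n u))"
        unfolding H_def by (rule finite_measure_subadditive_finite[OF Tfin]) (use E in blast)
      also have "\<dots> \<le> (\<Sum>u\<in>T n. \<bar>C\<bar> / real n ^ 5)"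
      proof (rule sum_mono)
        fix u assume "u \<in> T n"
        then have u: "1 \<le> fst u" "1 \<le> snd u" "fst u \<noteq> snd u"
          by (auto simp: T_def)
        have "prob (E n u) \<le> C / real n ^ 5"
          using elim(1) u unfolding E_def by blast
        also have "\<dots> \<le> \<bar>C\<bar> / real n ^ 5"
          by (rule divide_right_mono) auto
        finally show "prob (E n u) \<le> \<bar>C\<bar> / real n ^ 5" .
      qed
      also have "\<dots> = real (card (T n)) * (\<bar>C\<bar> / real n ^ 5)"
        by simp
      also have "\<dots> \<le> (real R * real n)\<^sup>2 * (\<bar>C\<bar> / real n ^ 5)"
      proof (rule mult_right_mono)
        have "card (T n) \<le> (R * n) * (R * n)"
          using Tcard[of n] mult_le_mono[OF R R, of n n] elim(2) by linarith
        then have "real (card (T n)) \<le> real ((R * n) * (R * n))"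
          by (rule of_nat_mono)
        then show "real (card (T n)) \<le> (real R * real n)\<^sup>2"
          by (simp add: power2_eq_square)
      qed simp
      also have "\<dots> = \<bar>C\<bar> * (real R)\<^sup>2 * inverse (real n ^ 3)"
        using elim(2) by (simp add: field_simps power_numeral_reduce)
      finally show ?case by simp
    qed
  qed
  then have "AE \<omega> in M. \<forall>\<^sub>F n in sequentially. \<omega> \<in> space M - H n"
    by (intro borel_cantelli_AE1 H) (simp_all add: emeasure_eq_measure)
  then show ?thesis
  proof eventually_elim
    case (elim \<omega>)
    then show ?case
    proof eventually_elim
      case (elim n)
      show ?case
      proof (intro allI impI)
        fix i j :: nat assume "1 \<le> i" "i < j" "j \<le> p n"
        then have "(i, j) \<in> T n" by (simp add: T_def)
        then have "\<omega> \<notin> E n (i, j)"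
          using elim unfolding H_def by blast
        then show "\<bar>\<Sum>k=1..n. trunc (y n) (X k i \<omega> * X k j \<omega>)\<bar> < x n"
          using elim unfolding E_def by (simp add: not_le)
      qed
    qed
  qed
qed

text \<open>A separate union bound for every \<open>n\<close> would need the sum of \<open>n\<close>
  times \<open>q\<close> to be finite. Instead one event \<open>G l\<close> serves all
  \<open>n\<close> with \<open>2 ^ l \<le> n < 2 ^ (l + 1)\<close>: its rows and columns are taken
  at the right end of this range, its threshold at the left end.\<close>

lemma eventually_entries_small:
  assumes \<alpha>: "0 < \<alpha>" and e: "0 < e" and sum: "summable (\<lambda>n. q n (real n powr \<alpha>))"
    and R: "\<And>n. 1 \<le> n \<Longrightarrow> p n \<le> R * n"
  shows "AE \<omega> in M. \<forall>\<^sub>F n in sequentially. \<forall>k i j. 1 \<le> k \<longrightarrow> k \<le> n \<longrightarrow> 1 \<le> i \<longrightarrow> i < j \<longrightarrow> j \<le> p n \<longrightarrow>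
      \<bar>X k i \<omega> * X k j \<omega>\<bar> < e * real n powr \<alpha>"
proof -
  define G where "G k = (\<Union>r\<in>{1..2 ^ (k + 1)}. big r {1..R * 2 ^ (k + 1)} (e * (2 ^ k) powr \<alpha>))" for k
  have G: "G k \<in> events" for k
    unfolding G_def by (rule sets.finite_UN) (auto intro!: big_sets)
  have "summable (\<lambda>k. prob (G k))"
  proof (rule summable_comparison_test_ev)
    show "summable (\<lambda>k. 2 ^ (k + 1) * q (R * 2 ^ (k + 1)) (e * (2 ^ k) powr \<alpha>))"
      by (rule dyadic_summable[OF \<alpha> e sum])
    have "prob (G k) \<le> 2 ^ (k + 1) * q (R * 2 ^ (k + 1)) (e * (2 ^ k) powr \<alpha>)" for k
    proof -
      have "prob (G k) \<le> (\<Sum>r\<in>{1..2 ^ (k + 1)}. prob (big r {1..R * 2 ^ (k + 1)} (e * (2 ^ k) powr \<alpha>)))"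
        unfolding G_def by (rule finite_measure_subadditive_finite) (auto intro!: big_sets)
      also have "\<dots> \<le> (\<Sum>r\<in>{1..2 ^ (k + 1)::nat}. q (R * 2 ^ (k + 1)) (e * (2 ^ k) powr \<alpha>))"
        by (intro sum_mono prob_big_le) auto
      also have "\<dots> = 2 ^ (k + 1) * q (R * 2 ^ (k + 1)) (e * (2 ^ k) powr \<alpha>)"
        by simp
      finally show ?thesis .
    qed
    then show "\<forall>\<^sub>F k in sequentially. norm (prob (G k)) \<le> 2 ^ (k + 1) * q (R * 2 ^ (k + 1)) (e * (2 ^ k) powr \<alpha>)"
      by simp
  qed
  then have "AE \<omega> in M. \<forall>\<^sub>F k in sequentially. \<omega> \<in> space M - G k"
    by (intro borel_cantelli_AE1 G) (simp_all add: emeasure_eq_measure)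
  then show ?thesis
  proof eventually_elim
    case (elim \<omega>)
    then obtain k0 where k0: "\<And>k. k0 \<le> k \<Longrightarrow> \<omega> \<in> space M - G k"
      unfolding eventually_sequentially by blast
    show ?case
      using eventually_ge_at_top[of "2 ^ k0"]
    proof eventually_elim
      case (elim n)
      have n1: "1 \<le> n"
        using elim order_trans[of 1 "2 ^ k0" n] by simp
      obtain l where l: "2 ^ l \<le> n" "n < 2 ^ (l + 1)"
        using ex_power_ivl1[of 2 n] n1 by auto
      have "(2::nat) ^ k0 < 2 ^ (l + 1)"
        using elim l(2) by linarith
      then have "k0 < l + 1"
        by (simp only: power_strict_increasing_iff one_less_numeral_iff semiring_norm)
      then have \<omega>: "\<omega> \<in> space M - G l"
        by (intro k0) simp
      have "(2::real) ^ l \<le> real n"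
        using l(1) by (metis of_nat_le_iff of_nat_numeral of_nat_power)
      then have pw: "e * (2 ^ l) powr \<alpha> \<le> e * real n powr \<alpha>"
        using e \<alpha> by (intro mult_left_mono powr_mono2) auto
      show ?case
      proof (intro allI impI)
        fix k i j assume k: "1 \<le> k" "k \<le> n" and ij: "1 \<le> i" "i < j" "j \<le> p n"
        have "p n \<le> R * 2 ^ (l + 1)"
          using R[OF n1] mult_le_mono2[of n "2 ^ (l + 1)" R] l(2) by linarith
        then have ij': "i \<in> {1..R * 2 ^ (l + 1)}" "j \<in> {1..R * 2 ^ (l + 1)}" "i \<noteq> j"
          using ij unfolding atLeastAtMost_iff by linarith+
        have "k \<in> {1..2 ^ (l + 1)}"
          using k l(2) unfolding atLeastAtMost_iff by linarith
        then have "\<omega> \<notin> big k {1..R * 2 ^ (l + 1)} (e * (2 ^ l) powr \<alpha>)"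
          using \<omega> unfolding G_def by blast
        then have "\<not> e * (2 ^ l) powr \<alpha> \<le> \<bar>X k i \<omega> * X k j \<omega>\<bar>"
          using \<omega> ij' unfolding big_def by blast
        then show "\<bar>X k i \<omega> * X k j \<omega>\<bar> < e * real n powr \<alpha>"
          using pw by linarith
      qed
    qed
  qed
qed

text \<open>Both almost sure bounds are used with the same \<open>e\<close>: once every product is
  below the truncation level, \<open>trunc\<close> acts as the identity on all summands, and the
  bound for truncated sums becomes one for the original sums.\<close>

lemma W_stat_tendsto_zero:
  assumes \<alpha>: "1 / 2 < \<alpha>" and sum: "summable (\<lambda>n. q n (real n powr \<alpha>))"
    and mean: "\<alpha> \<le> 1 \<Longrightarrow> integrable M (X 1 1) \<and> expectation (X 1 1) = 0"
    and R: "\<And>n. 1 \<le> n \<Longrightarrow> p n \<le> R * n"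
  shows "AE \<omega> in M. (\<lambda>n. W_stat X p n \<omega> / real n powr \<alpha>) \<longlonglongrightarrow> 0"
proof -
  have \<alpha>0: "0 < \<alpha>"
    using \<alpha> by simp
  have *: "AE \<omega> in M. \<forall>\<^sub>F n in sequentially. W_stat X p n \<omega> < \<epsilon> * real n powr \<alpha>"
    if \<epsilon>: "0 < \<epsilon>" for \<epsilon>
  proof -
    obtain e where e: "0 < e" and
      tail: "\<forall>\<^sub>F n in sequentially. \<forall>i j. 1 \<le> i \<longrightarrow> 1 \<le> j \<longrightarrow> i \<noteq> j \<longrightarrow>
      prob {\<omega> \<in> space M. \<epsilon> * real n powr \<alpha>
          \<le> \<bar>\<Sum>k=1..n. trunc (e * real n powr \<alpha>) (X k i \<omega> * X k j \<omega>)\<bar>}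
        \<le> 2 * exp 1 / real n ^ 5"
      using truncated_sum_tail[OF \<alpha> sum mean \<epsilon>] by blast
    have "AE \<omega> in M. \<forall>\<^sub>F n in sequentially. \<forall>i j. 1 \<le> i \<longrightarrow> i < j \<longrightarrow> j \<le> p n \<longrightarrow>
        \<bar>\<Sum>k=1..n. trunc (e * real n powr \<alpha>) (X k i \<omega> * X k j \<omega>)\<bar> < \<epsilon> * real n powr \<alpha>"
      by (rule eventually_truncated_small[OF _ tail]) (rule R)
    moreover have "AE \<omega> in M. \<forall>\<^sub>F n in sequentially. \<forall>k i j. 1 \<le> k \<longrightarrow> k \<le> n \<longrightarrow> 1 \<le> i \<longrightarrow> i < j \<longrightarrow>
        j \<le> p n \<longrightarrow> \<bar>X k i \<omega> * X k j \<omega>\<bar> < e * real n powr \<alpha>"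
      by (rule eventually_entries_small[OF \<alpha>0 e sum]) (rule R)
    ultimately show ?thesis
    proof eventually_elim
      case (elim \<omega>)
      from elim(1) elim(2) eventually_ge_at_top[of 1] show ?case
      proof eventually_elim
        case (elim n)
        show ?case
        proof (rule W_stat_less)
          show "0 < \<epsilon> * real n powr \<alpha>"
            using elim(3) \<epsilon> by simp
          fix i j assume ij: "1 \<le> i" "i < j" "j \<le> p n"
          have "(\<Sum>k=1..n. trunc (e * real n powr \<alpha>) (X k i \<omega> * X k j \<omega>)) = (\<Sum>k=1..n. X k i \<omega> * X k j \<omega>)"
            by (intro sum.cong refl) (use elim(2) ij in \<open>auto simp: trunc_def\<close>)
          then show "\<bar>\<Sum>k=1..n. X k i \<omega> * X k j \<omega>\<bar> < \<epsilon> * real n powr \<alpha>"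
            using elim(1) ij by metis
        qed
      qed
    qed
  qed
  \<comment> \<open>The exceptional null set depends on \<epsilon>, so the quantifiers are exchanged
    along the countable family 1 / (m + 1).\<close>
  have "AE \<omega> in M. \<forall>m::nat. \<forall>\<^sub>F n in sequentially. W_stat X p n \<omega> < inverse (real (Suc m)) * real n powr \<alpha>"
    unfolding AE_all_countable by (intro allI *) simp
  then show ?thesis
  proof eventually_elim
    case (elim \<omega>)
    show ?case
    proof (rule LIMSEQ_I)
      fix \<epsilon> :: real assume "0 < \<epsilon>"
      then obtain m where m: "inverse (real (Suc m)) < \<epsilon>"
        using reals_Archimedean by blast
      have "\<forall>\<^sub>F n in sequentially. norm (W_stat X p n \<omega> / real n powr \<alpha> - 0) < \<epsilon>"
        using elim[rule_format, of m] eventually_ge_at_top[of 1]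
      proof eventually_elim
        case (elim n)
        then have n: "0 < real n powr \<alpha>" by simp
        have "W_stat X p n \<omega> / real n powr \<alpha> < inverse (real (Suc m))"
          using elim(1) by (simp only: pos_divide_less_eq[OF n])
        then have "W_stat X p n \<omega> / real n powr \<alpha> < \<epsilon>"
          using m by linarith
        moreover have "0 \<le> W_stat X p n \<omega> / real n powr \<alpha>"
          using W_stat_nonneg by (intro divide_nonneg_pos n)
        ultimately show ?case by simp
      qed
      then show "\<exists>no. \<forall>n\<ge>no. norm (W_stat X p n \<omega> / real n powr \<alpha> - 0) < \<epsilon>"
        by (simp only: eventually_sequentially)
    qed
  qed
qed

subsection \<open>Necessity\<close>

text \<open>The \<open>n\<close>-th predicate reads only the entries in \<open>K n\<close>, and
  these sets lie in different rows. The successor matches natural number indices starting at 0 with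
  rows starting at 1.\<close>

lemma indep_rows:
  "indep_vars (\<lambda>_. count_space UNIV)
    (\<lambda>n \<omega>. \<exists>i\<in>{1..L n}. \<exists>j\<in>{1..L n}. i \<noteq> j \<and> x n \<le> \<bar>X (Suc n) i \<omega> * X (Suc n) j \<omega>\<bar>) UNIV"
proof -
  define K where "K n = {Suc n} \<times> {1..L n}" for n
  have "indep_vars (\<lambda>n. PiM (K n) (\<lambda>_. borel))
      (\<lambda>n \<omega>. restrict (\<lambda>u. case_prod X u \<omega>) (K n)) UNIV"
  proof (rule indep_vars_restrict)
    show "indep_vars (\<lambda>_. borel) (\<lambda>u. case_prod X u) idx"
      using indep .
    show "K n \<subseteq> idx" for n
      by (auto simp: K_def)
    show "disjoint_family_on K UNIV"
      by (auto simp: disjoint_family_on_def K_def)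
  qed
  then have "indep_vars (\<lambda>_. count_space UNIV)
      (\<lambda>n \<omega>. (\<lambda>v. \<exists>i\<in>{1..L n}. \<exists>j\<in>{1..L n}. i \<noteq> j \<and> x n \<le> \<bar>v (Suc n, i) * v (Suc n, j)\<bar>)
        (restrict (\<lambda>u. case_prod X u \<omega>) (K n))) UNIV"
  proof (rule indep_vars_compose2)
    fix n
    have [measurable]: "(\<lambda>v. v (Suc n, i)) \<in> borel_measurable (PiM (K n) (\<lambda>_. borel :: real measure))"
      if "i \<in> {1..L n}" for i
      by (rule measurable_component_singleton) (use that in \<open>simp add: K_def\<close>)
    show "Measurable.pred (PiM (K n) (\<lambda>_. borel :: real measure))
        (\<lambda>v. \<exists>i\<in>{1..L n}. \<exists>j\<in>{1..L n}. i \<noteq> j \<and> x n \<le> \<bar>v (Suc n, i) * v (Suc n, j)\<bar>)"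
      by measurable
  qed
  moreover have "(\<exists>i\<in>{1..L n}. \<exists>j\<in>{1..L n}. i \<noteq> j \<and>
        x n \<le> \<bar>restrict (\<lambda>u. case_prod X u \<omega>) (K n) (Suc n, i) * restrict (\<lambda>u. case_prod X u \<omega>) (K n) (Suc n, j)\<bar>)
      \<longleftrightarrow> (\<exists>i\<in>{1..L n}. \<exists>j\<in>{1..L n}. i \<noteq> j \<and> x n \<le> \<bar>X (Suc n) i \<omega> * X (Suc n) j \<omega>\<bar>)" for n \<omega>
    by (intro bex_cong refl) (simp add: K_def)
  ultimately show ?thesis
    by simp
qed

text \<open>For a pair of columns present at both times, the product in row \<open>n + 1\<close> is
  the difference of two consecutive sums. If the statistic is below half of the threshold at
  \<open>n\<close> and at \<open>n + 1\<close>, the product stays below the threshold. The resulting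
  series over \<open>L n\<close> columns is then scaled back to \<open>n + 1\<close>
  columns.\<close>

lemma summable_of_W_stat:
  assumes \<alpha>: "0 < \<alpha>" and R: "\<And>n. 1 \<le> n \<Longrightarrow> n \<le> R * p n" and R0: "0 < R"
    and lim: "AE \<omega> in M. (\<lambda>n. W_stat X p n \<omega> / real n powr \<alpha>) \<longlonglongrightarrow> 0"
  shows "summable (\<lambda>n. q n (real n powr \<alpha>))"
proof -
  \<comment> \<open>The factor 2 makes the same columns available at time \<open>n\<close> too: for
    n \<ge> 1, n + 1 \<le> 2 n \<le> 2 R p(n).\<close>
  define L where "L n = Suc n div (2 * R)" for n
  define x where "x n = real (Suc n) powr \<alpha>" for n
  define P where "P n \<omega> \<longleftrightarrow> (\<exists>i\<in>{1..L n}. \<exists>j\<in>{1..L n}. i \<noteq> j \<and> x n \<le> \<bar>X (Suc n) i \<omega> * X (Suc n) j \<omega>\<bar>)"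
    for n \<omega>
  have Lp: "L n \<le> p (Suc n)" "L n \<le> p n" if n: "1 \<le> n" for n
  proof -
    have "Suc n \<le> p (Suc n) * (2 * R)" "Suc n \<le> p n * (2 * R)"
      using R[of "Suc n"] R[OF n] n by (auto simp: algebra_simps)
    then show "L n \<le> p (Suc n)" "L n \<le> p n"
      unfolding L_def using R0 by (metis div_le_mono div_mult_self_is_m mult_pos_pos zero_less_numeral)+
  qed
  have "AE \<omega> in M. \<forall>\<^sub>F n in sequentially. \<not> P n \<omega>"
    using lim
  proof eventually_elim
    case (elim \<omega>)
    then have W: "\<forall>\<^sub>F n in sequentially. W_stat X p n \<omega> / real n powr \<alpha> < 1 / 2"
      by (rule order_tendstoD) simp
    from W W[THEN eventually_sequentially_Suc[THEN iffD2]] eventually_ge_at_top[of 1]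
    show ?case
    proof eventually_elim
      case (elim n)
      have "W_stat X p n \<omega> < 1 / 2 * real n powr \<alpha>"
        using elim(1,3) by (simp add: pos_divide_less_eq)
      also have "\<dots> \<le> 1 / 2 * x n"
        using \<alpha> unfolding x_def by (intro mult_left_mono powr_mono2) auto
      finally have W1: "W_stat X p n \<omega> < 1 / 2 * x n" .
      have W2: "W_stat X p (Suc n) \<omega> < 1 / 2 * x n"
        using elim(2) by (simp add: pos_divide_less_eq x_def)
      have less: "\<bar>X (Suc n) i \<omega> * X (Suc n) j \<omega>\<bar> < x n" if ij: "1 \<le> i" "i < j" "j \<le> L n" for i j
      proof -
        have "\<bar>\<Sum>k=1..Suc n. X k i \<omega> * X k j \<omega>\<bar> \<le> W_stat X p (Suc n) \<omega>"
          by (rule W_stat_ge) (use ij Lp(1)[OF elim(3)] in auto)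
        moreover have "\<bar>\<Sum>k=1..n. X k i \<omega> * X k j \<omega>\<bar> \<le> W_stat X p n \<omega>"
          by (rule W_stat_ge) (use ij Lp(2)[OF elim(3)] in auto)
        moreover have "(\<Sum>k=1..Suc n. X k i \<omega> * X k j \<omega>)
            = (\<Sum>k=1..n. X k i \<omega> * X k j \<omega>) + X (Suc n) i \<omega> * X (Suc n) j \<omega>"
          by simp
        ultimately show ?thesis
          using W1 W2 by linarith
      qed
      show ?case
      proof
        assume "P n \<omega>"
        then obtain i j where ij: "i \<in> {1..L n}" "j \<in> {1..L n}" "i \<noteq> j"
          "x n \<le> \<bar>X (Suc n) i \<omega> * X (Suc n) j \<omega>\<bar>"
          unfolding P_def by blast
        then consider "i < j" | "j < i" by linarith
        then show False
        proof cases
          case 1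
          then show False
            using less[of i j] ij by auto
        next
          case 2
          then show False
            using less[of j i] ij by (auto simp: mult.commute)
        qed
      qed
    qed
  qed
  then have "summable (\<lambda>n. prob {\<omega> \<in> space M. P n \<omega>})"
    using indep_rows[of L x] unfolding P_def[abs_def, symmetric] by (intro borel_cantelli_converse)
  moreover have "{\<omega> \<in> space M. P n \<omega>} = big (Suc n) {1..L n} (x n)" for n
    by (simp only: big_def P_def)
  moreover have "prob (big (Suc n) {1..L n} (x n)) = q (L n) (x n)" for n
    using prob_big_eq[of "Suc n" "{1..L n}" "x n"] by simp
  ultimately have sum: "summable (\<lambda>n. q (L n) (x n))"
    by simp
  have "summable (\<lambda>n. q (Suc n) (x n))"
  proof (rule summable_comparison_test_ev)
    show "summable (\<lambda>n. 9 * (real (4 * R))\<^sup>2 * q (L n) (x n))"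
      by (rule summable_mult[OF sum])
    show "\<forall>\<^sub>F n in sequentially. norm (q (Suc n) (x n)) \<le> 9 * (real (4 * R))\<^sup>2 * q (L n) (x n)"
      using eventually_ge_at_top[of "4 * R"]
    proof eventually_elim
      case (elim n)
      \<comment> \<open>With \<open>L n\<close> at least 2 the column scaling applies; the remainder
        of the division is below \<open>2 * R\<close>, hence below \<open>2 * R * L n\<close>, which
        gives the factor \<open>4 * R\<close>.\<close>
      have L2: "2 \<le> L n"
        unfolding L_def using elim R0 by (simp add: less_eq_div_iff_mult_less_eq)
      have "Suc n = 2 * R * L n + Suc n mod (2 * R)" "Suc n mod (2 * R) < 2 * R"
        unfolding L_def using R0 by auto
      moreover have "2 * R * 1 \<le> 2 * R * L n"
        using L2 by (intro mult_le_mono2) auto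
      ultimately have "Suc n \<le> 4 * R * L n"
        by linarith
      then show ?case
        using q_scale_le[OF L2, of "Suc n" "4 * R" "x n"] by simp
    qed
  qed
  then show ?thesis
    unfolding x_def by (rule summable_Suc_iff[THEN iffD1])
qed

text \<open>Independence factors the second moment of the product into \<open>c * c\<close>, with
  \<open>c\<close> the possibly infinite second moment of one entry. Working with nonnegative
  integrals allows this before finiteness is known; an infinite \<open>c\<close> would make the
  product infinite.\<close>

lemma integrable_entry_square:
  assumes int: "integrable M (\<lambda>\<omega>. (Y12 \<omega>)\<^sup>2)"
  shows "integrable M (\<lambda>\<omega>. (X 1 1 \<omega>)\<^sup>2)"
proof -
  have rv12: "random_variable borel (X 1 1)" "random_variable borel (X 1 2)"
    by (rule rv; simp)+
  note [measurable] = rv12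
  have distr12: "distr M borel (X 1 2) = distr M borel (X 1 1)"
    by (rule ident) simp_all
  define c where "c = (\<integral>\<^sup>+\<omega>. ennreal ((X 1 1 \<omega>)\<^sup>2) \<partial>M)"
  have c2: "(\<integral>\<^sup>+\<omega>. ennreal ((X 1 2 \<omega>)\<^sup>2) \<partial>M) = c"
  proof -
    have *: "(\<integral>\<^sup>+\<omega>. ennreal ((X 1 i \<omega>)\<^sup>2) \<partial>M) = (\<integral>\<^sup>+z. ennreal (z\<^sup>2) \<partial>distr M borel (X 1 i))"
      if "random_variable borel (X 1 i)" for i
      by (rule nn_integral_distr[OF that, symmetric]) measurable
    show ?thesis
      unfolding c_def *[OF rv12(1)] *[OF rv12(2)] distr12 ..
  qed
  let ?J = "{(1::nat, 1::nat), (1, 2)}"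
  have "indep_vars (\<lambda>_. borel) (\<lambda>u. case_prod X u) ?J"
    by (rule indep_vars_subset[OF indep]) auto
  then have "indep_vars (\<lambda>_. borel) (\<lambda>u \<omega>. ennreal ((case_prod X u \<omega>)\<^sup>2)) ?J"
    by (rule indep_vars_compose2) measurable
  then have "(\<integral>\<^sup>+\<omega>. (\<Prod>u\<in>?J. ennreal ((case_prod X u \<omega>)\<^sup>2)) \<partial>M)
      = (\<Prod>u\<in>?J. \<integral>\<^sup>+\<omega>. ennreal ((case_prod X u \<omega>)\<^sup>2) \<partial>M)"
    by (intro indep_vars_nn_integral) auto
  then have "(\<integral>\<^sup>+\<omega>. ennreal ((X 1 1 \<omega>)\<^sup>2) * ennreal ((X 1 2 \<omega>)\<^sup>2) \<partial>M) = c * c"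
    using c2 by (simp add: c_def)
  then have "c * c = (\<integral>\<^sup>+\<omega>. ennreal ((Y12 \<omega>)\<^sup>2) \<partial>M)"
    by (simp add: ennreal_mult[symmetric] power_mult_distrib)
  also have "\<dots> < \<infinity>"
    using int by (simp add: integrable_iff_bounded)
  finally have "c < \<infinity>"
    by (cases "c = \<infinity>") (auto simp: ennreal_top_mult less_top)
  then have "(\<integral>\<^sup>+\<omega>. ennreal ((X 1 1 \<omega>)\<^sup>2) \<partial>M) < \<infinity>"
    by (simp only: c_def)
  moreover have "random_variable borel (\<lambda>\<omega>. (X 1 1 \<omega>)\<^sup>2)"
    by measurable
  ultimately show ?thesis
    by (intro integrableI_nonneg) simp_all
qed

text \<open>For \<alpha> \<le> 1 the order \<open>2 / \<alpha>\<close> is at least 2, so the product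
  of two entries has a variance. If its mean \<open>m\<close> were nonzero, the sum for columns 1
  and 2 would be near n m, whereas the limit keeps it below n |m| / 2.\<close>

lemma mean_zero_of_W_stat:
  assumes \<alpha>: "0 < \<alpha>" "\<alpha> \<le> 1" and R: "\<And>n. 1 \<le> n \<Longrightarrow> n \<le> R * p n"
    and lim: "AE \<omega> in M. (\<lambda>n. W_stat X p n \<omega> / real n powr \<alpha>) \<longlonglongrightarrow> 0"
    and sum: "summable (\<lambda>n. q n (real n powr \<alpha>))"
  shows "integrable M (X 1 1) \<and> expectation (X 1 1) = 0"
proof -
  have rv11: "random_variable borel (X 1 1)"
    by (rule rv) simp_all
  have "integrable M (\<lambda>\<omega>. \<bar>Y12 \<omega>\<bar> powr 2)"
    by (rule integrable_Y12_powr[OF \<alpha>(1) sum]) (use \<alpha> in \<open>auto simp: field_simps\<close>)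
  moreover have "\<bar>z\<bar> powr 2 = z\<^sup>2" for z :: real
    by (simp add: powr_numeral)
  ultimately have Y2: "integrable M (\<lambda>\<omega>. (Y12 \<omega>)\<^sup>2)"
    by (simp only:)
  have Y1: "integrable M Y12"
    by (rule square_integrable_imp_integrable[OF rv_Y12 Y2])
  have int: "integrable M (X 1 1)"
    by (rule square_integrable_imp_integrable[OF rv11 integrable_entry_square[OF Y2]])
  define m where "m = expectation Y12"
  have m: "m = expectation (X 1 1) * expectation (X 1 1)"
    unfolding m_def by (rule expectation_Y12(2)[OF int])
  define V where "V k \<omega> = X k 1 \<omega> * X k 2 \<omega> - m" for k \<omega>
  define v where "v = expectation (\<lambda>\<omega>. (Y12 \<omega> - m)\<^sup>2)"
  have indV: "indep_vars (\<lambda>_. borel) V {1..n}" for n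
  proof -
    have "indep_vars (\<lambda>_. borel) (\<lambda>k \<omega>. (X k 1 \<omega> * X k 2 \<omega>) - m) {1..n}"
      by (rule indep_vars_compose2[OF indep_entry_products]) simp_all
    then show ?thesis by (simp only: V_def[abs_def])
  qed
  have "(\<lambda>\<omega>. (Y12 \<omega> - m)\<^sup>2) = (\<lambda>\<omega>. (Y12 \<omega>)\<^sup>2 - 2 * m * Y12 \<omega> + m\<^sup>2)"
    by (simp add: fun_eq_iff power2_eq_square algebra_simps)
  then have Ym2: "integrable M (\<lambda>\<omega>. (Y12 \<omega> - m)\<^sup>2)"
    using Y1 Y2 by simp
  have V: "integrable M (\<lambda>\<omega>. (V k \<omega>)\<^sup>2)" "expectation (V k) = 0" "expectation (\<lambda>\<omega>. (V k \<omega>)\<^sup>2) = v"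
    if k: "1 \<le> k" for k
  proof -
    have f1: "(\<lambda>z::real. (z - m)\<^sup>2) \<in> borel_measurable borel" and f2: "(\<lambda>z::real. z - m) \<in> borel_measurable borel"
      by measurable
    show "integrable M (\<lambda>\<omega>. (V k \<omega>)\<^sup>2)"
      using expectation_entry_product(2)[OF f1 k, of 1 2] Ym2 by (simp add: V_def)
    show "expectation (\<lambda>\<omega>. (V k \<omega>)\<^sup>2) = v"
      using expectation_entry_product(1)[OF f1 k, of 1 2] by (simp add: V_def v_def)
    show "expectation (V k) = 0"
      using expectation_entry_product(1)[OF f2 k, of 1 2] Y1
      by (simp add: V_def[abs_def] m_def prob_space)
  qed
  have "m = 0"
  proof (rule ccontr)
    assume m0: "m \<noteq> 0"
    define A where "A n = {\<omega> \<in> space M. (real n * m / 2)\<^sup>2 \<le> (\<Sum>k=1..n. V k \<omega>)\<^sup>2}" for n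
    have intS: "integrable M (\<lambda>\<omega>. (\<Sum>k=1..n. V k \<omega>)\<^sup>2)"
      and ES: "expectation (\<lambda>\<omega>. (\<Sum>k=1..n. V k \<omega>)\<^sup>2) = real n * v" for n
      using expectation_sum_square[OF indV[of n]] V by simp_all
    have A: "A n \<in> events" for n
      unfolding A_def using borel_measurable_integrable[OF intS] by measurable
    have PA: "prob (A n) \<le> 4 * v / m\<^sup>2 * (1 / real n)" if n: "1 \<le> n" for n
    proof -
      have "0 < (real n * m / 2)\<^sup>2"
        using n m0 by simp
      then have "prob (A n) \<le> expectation (\<lambda>\<omega>. (\<Sum>k=1..n. V k \<omega>)\<^sup>2) / (real n * m / 2)\<^sup>2"
        unfolding A_def by (intro integral_Markov_inequality_measure[OF intS sets.empty_sets]) auto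
      also have "\<dots> = 4 * v / m\<^sup>2 * (1 / real n)"
        unfolding ES using n m0 by (simp add: field_simps power2_eq_square)
      finally show ?thesis .
    qed
    \<comment> \<open>Chebyshev's bound of order 1 / n is not summable over all n, but along powers
      of two it is geometric; a subsequence suffices for the contradiction.\<close>
    have "summable (\<lambda>k. prob (A (2 ^ k)))"
    proof (rule summable_comparison_test)
      show "\<exists>N. \<forall>k\<ge>N. norm (prob (A (2 ^ k))) \<le> 4 * v / m\<^sup>2 * (1 / 2) ^ k"
        using PA[of "2 ^ _"] by (simp add: power_divide)
      show "summable (\<lambda>k. 4 * v / m\<^sup>2 * (1 / 2) ^ k)"
        by (intro summable_mult summable_geometric) simp
    qed
    then have "AE \<omega> in M. \<forall>\<^sub>F k in sequentially. \<omega> \<in> space M - A (2 ^ k)"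
      by (intro borel_cantelli_AE1 A) (simp_all add: emeasure_eq_measure)
    with lim have "AE \<omega> in M. False"
    proof eventually_elim
      case (elim \<omega>)
      have "\<forall>\<^sub>F n in sequentially. W_stat X p n \<omega> / real n powr \<alpha> < \<bar>m\<bar> / 2"
        using elim(1) by (rule order_tendstoD) (use m0 in simp)
      moreover have lim2: "filterlim (\<lambda>k. (2::nat) ^ k) at_top sequentially"
        by (rule filterlim_subseq) (simp add: strict_mono_def)
      ultimately have W: "\<forall>\<^sub>F k in sequentially. W_stat X p (2 ^ k) \<omega> / real (2 ^ k) powr \<alpha> < \<bar>m\<bar> / 2"
        by (rule eventually_compose_filterlim)
      \<comment> \<open>This forces \<open>p (2 ^ k)\<close> to be at least 2, so that the pair of
        columns 1 and 2 is among those in the maximum.\<close>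
      have "\<forall>\<^sub>F k in sequentially. R < (2::nat) ^ k"
        by (rule eventually_compose_filterlim[OF eventually_gt_at_top lim2])
      with W elim(2) have "\<forall>\<^sub>F k in sequentially::nat filter. False"
      proof eventually_elim
        case (elim k)
        define n :: nat where "n = 2 ^ k"
        have n: "1 \<le> n"
          by (simp add: n_def)
        have "p n \<ge> 2"
        proof (rule ccontr)
          assume "\<not> 2 \<le> p n"
          then have "R * p n \<le> R * 1"
            by (intro mult_le_mono2) simp
          with R[OF n] elim(3) show False
            unfolding n_def by linarith
        qed
        then have "\<bar>\<Sum>k=1..n. X k 1 \<omega> * X k 2 \<omega>\<bar> \<le> W_stat X p n \<omega>"
          by (intro W_stat_ge) auto
        also have "\<dots> < \<bar>m\<bar> / 2 * real n powr \<alpha>"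
          using elim(1) n by (simp add: n_def[symmetric] pos_divide_less_eq)
        also have "\<dots> \<le> \<bar>m\<bar> / 2 * real n"
          using powr_mono[of \<alpha> 1 "real n"] \<alpha> n by (intro mult_left_mono) auto
        finally have S: "\<bar>\<Sum>k=1..n. X k 1 \<omega> * X k 2 \<omega>\<bar> < \<bar>m\<bar> / 2 * real n" .
        have "\<bar>\<Sum>k=1..n. V k \<omega>\<bar> = \<bar>(\<Sum>k=1..n. X k 1 \<omega> * X k 2 \<omega>) - real n * m\<bar>"
          by (simp add: V_def sum_subtractf)
        moreover have "\<bar>real n * m\<bar> = \<bar>m\<bar> * real n"
          by (simp add: abs_mult)
        ultimately have "\<bar>real n * m\<bar> / 2 \<le> \<bar>\<Sum>k=1..n. V k \<omega>\<bar>"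
          using S by linarith
        then have "\<bar>real n * m / 2\<bar> \<le> \<bar>\<Sum>k=1..n. V k \<omega>\<bar>"
          by simp
        then have "(real n * m / 2)\<^sup>2 \<le> (\<Sum>k=1..n. V k \<omega>)\<^sup>2"
          by (simp only: abs_le_square_iff)
        then show False
          using elim(2) by (simp add: A_def n_def)
      qed
      then show False by simp
    qed
    then show False by simp
  qed
  \<comment> \<open>Since \<open>m\<close> is the square of the mean of an entry, that mean vanishes
    as well.\<close>
  then show ?thesis
    using int m by simp
qed

text \<open>Positivity of \<open>x\<close> rules out the value 0 inserted into the maximum, and
  commutativity of the product reconciles \<open>i < j\<close> with
  \<open>i \<noteq> j\<close>.\<close>

lemma max_prod_ge_eq_big:
  assumes "0 < x"
  shows "{\<omega> \<in> space M. x \<le> max_prod X n \<omega>} = big 1 {1..n} x"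
proof -
  have "x \<le> max_prod X n \<omega> \<longleftrightarrow> (\<exists>i\<in>{1..n}. \<exists>j\<in>{1..n}. i \<noteq> j \<and> x \<le> \<bar>X 1 i \<omega> * X 1 j \<omega>\<bar>)" for \<omega>
  proof
    assume "x \<le> max_prod X n \<omega>"
    then obtain z where "z \<in> insert 0 {\<bar>X 1 i \<omega> * X 1 j \<omega>\<bar> | i j. 1 \<le> i \<and> i < j \<and> j \<le> n}" "x \<le> z"
      unfolding max_prod_def by (subst (asm) Max_ge_iff[OF finite_pair_values]) auto
    then obtain i j where "1 \<le> i" "i < j" "j \<le> n" "x \<le> \<bar>X 1 i \<omega> * X 1 j \<omega>\<bar>"
      using assms by auto
    then show "\<exists>i\<in>{1..n}. \<exists>j\<in>{1..n}. i \<noteq> j \<and> x \<le> \<bar>X 1 i \<omega> * X 1 j \<omega>\<bar>"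
      by (intro bexI[of _ i] bexI[of _ j]) auto
  next
    assume "\<exists>i\<in>{1..n}. \<exists>j\<in>{1..n}. i \<noteq> j \<and> x \<le> \<bar>X 1 i \<omega> * X 1 j \<omega>\<bar>"
    then obtain i j where ij: "i \<in> {1..n}" "j \<in> {1..n}" "i \<noteq> j" "x \<le> \<bar>X 1 i \<omega> * X 1 j \<omega>\<bar>"
      by blast
    have "\<exists>i j. 1 \<le> i \<and> i < j \<and> j \<le> n \<and> x \<le> \<bar>X 1 i \<omega> * X 1 j \<omega>\<bar>"
    proof (cases "i < j")
      case True
      then show ?thesis using ij by auto
    next
      case False
      then have "j < i" "x \<le> \<bar>X 1 j \<omega> * X 1 i \<omega>\<bar>"
        using ij by (simp_all add: mult.commute)
      then show ?thesis using ij by auto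
    qed
    then obtain i j where "1 \<le> i" "i < j" "j \<le> n" and x: "x \<le> \<bar>X 1 i \<omega> * X 1 j \<omega>\<bar>"
      by blast
    then have "\<bar>X 1 i \<omega> * X 1 j \<omega>\<bar> \<le> max_prod X n \<omega>"
      unfolding max_prod_def by (intro Max_ge[OF finite_pair_values]) blast
    with x show "x \<le> max_prod X n \<omega>" by linarith
  qed
  then show ?thesis
    unfolding big_def by simp
qed

end

theorem theorem2p1:
  fixes M :: "'a measure"
    and X :: "nat \<Rightarrow> nat \<Rightarrow> 'a \<Rightarrow> real"
    and p :: "nat \<Rightarrow> nat"
    and \<alpha> :: real
  assumes "prob_space M"
    and indep: "prob_space.indep_vars M (\<lambda>_. borel) (\<lambda>(k, i). X k i) ({1..} \<times> {1..})"
    and ident: "\<And>k i. 1 \<le> k \<Longrightarrow> 1 \<le> i \<Longrightarrow> distr M borel (X k i) = distr M borel (X 1 1)"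
    and p_pos: "\<And>n. 1 \<le> n \<Longrightarrow> p n \<ge> 1"
    and p_bdd: "\<exists>c C. 0 < c \<and> c \<le> C \<and>
                  (\<forall>n\<ge>1. c \<le> real n / real (p n) \<and> real n / real (p n) \<le> C)"
    and alpha: "\<alpha> > 1/2"
  shows "(AE \<omega> in M. (\<lambda>n. W_stat X p n \<omega> / real n powr \<alpha>) \<longlonglongrightarrow> 0)
         \<longleftrightarrow>
         (summable (\<lambda>n. measure M {\<omega> \<in> space M. max_prod X (Suc n) \<omega> \<ge> real (Suc n) powr \<alpha>})
          \<and> (\<alpha> \<le> 1 \<longrightarrow> integrable M (X 1 1) \<and> (\<integral>\<omega>. X 1 1 \<omega> \<partial>M) = 0))"
proof -
  interpret prob_space M by fact
  interpret iid_array M X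
    by unfold_locales (rule indep, rule ident)
  obtain c C where cC: "0 < c" "c \<le> C" and
    bd: "\<And>n. 1 \<le> n \<Longrightarrow> c \<le> real n / real (p n) \<and> real n / real (p n) \<le> C"
    using p_bdd by blast
  \<comment> \<open>The two-sided bound on n / p(n) is rounded to natural constants,
    \<open>R1\<close> bounding the number of columns from above and \<open>R2\<close> from below, so
    that column counts can be compared within the natural numbers.\<close>
  obtain R1 :: nat where R1: "1 / c \<le> real R1"
    using real_arch_simple by blast
  obtain R2 :: nat where R2: "C \<le> real R2"
    using real_arch_simple by blast
  have R2pos: "0 < R2"
    using R2 cC by (cases R2) auto
  have le1: "p n \<le> R1 * n" if n: "1 \<le> n" for n
  proof -
    have p: "0 < real (p n)"
      using p_pos[OF n] by simp
    have "c * real (p n) \<le> real n"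
      using bd[OF n] p by (simp only: pos_le_divide_eq)
    then have "real (p n) \<le> 1 / c * real n"
      using cC by (simp add: field_simps)
    also have "\<dots> \<le> real R1 * real n"
      by (rule mult_right_mono[OF R1]) simp
    finally show ?thesis
      by (simp only: of_nat_mult[symmetric] of_nat_le_iff)
  qed
  have le2: "n \<le> R2 * p n" if n: "1 \<le> n" for n
  proof -
    have p: "0 < real (p n)"
      using p_pos[OF n] by simp
    have "real n \<le> C * real (p n)"
      using bd[OF n] p by (simp only: pos_divide_le_eq)
    also have "\<dots> \<le> real R2 * real (p n)"
      by (rule mult_right_mono[OF R2]) simp
    finally show ?thesis
      by (simp only: of_nat_mult[symmetric] of_nat_le_iff)
  qed
  have \<alpha>0: "0 < \<alpha>"
    using alpha by simp
  \<comment> \<open>The series starts at n = 1, where the thresholds are positive as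
    \<open>max_prod_ge_eq_big\<close> requires; adding the term at 0 does not affect
    summability.\<close>
  have S: "summable (\<lambda>n. measure M {\<omega> \<in> space M. max_prod X (Suc n) \<omega> \<ge> real (Suc n) powr \<alpha>})
      \<longleftrightarrow> summable (\<lambda>n. q n (real n powr \<alpha>))"
  proof -
    have "measure M {\<omega> \<in> space M. max_prod X (Suc n) \<omega> \<ge> real (Suc n) powr \<alpha>}
        = q (Suc n) (real (Suc n) powr \<alpha>)" for n
      by (subst max_prod_ge_eq_big) auto
    then show ?thesis
      using summable_Suc_iff[of "\<lambda>n. q n (real n powr \<alpha>)"] by (simp only:)
  qed
  show ?thesis
    unfolding S
  proof
    assume lim: "AE \<omega> in M. (\<lambda>n. W_stat X p n \<omega> / real n powr \<alpha>) \<longlonglongrightarrow> 0"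
    have sum: "summable (\<lambda>n. q n (real n powr \<alpha>))"
      by (rule summable_of_W_stat[OF \<alpha>0 _ R2pos lim]) (rule le2)
    moreover have "integrable M (X 1 1) \<and> expectation (X 1 1) = 0" if "\<alpha> \<le> 1"
      by (rule mean_zero_of_W_stat[OF \<alpha>0 that _ lim sum]) (rule le2)
    ultimately show "summable (\<lambda>n. q n (real n powr \<alpha>))
        \<and> (\<alpha> \<le> 1 \<longrightarrow> integrable M (X 1 1) \<and> expectation (X 1 1) = 0)"
      by blast
  next
    assume *: "summable (\<lambda>n. q n (real n powr \<alpha>))
        \<and> (\<alpha> \<le> 1 \<longrightarrow> integrable M (X 1 1) \<and> expectation (X 1 1) = 0)"
    show "AE \<omega> in M. (\<lambda>n. W_stat X p n \<omega> / real n powr \<alpha>) \<longlonglongrightarrow> 0"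
      by (rule W_stat_tendsto_zero[OF alpha]) (use * le1 in blast)+
  qed
qed

end
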